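(* The primary unfolding of a Thom-Mather simple pseudomanifold is unique (up to bubble labeling): if $X$ is a Thom-Mather simple pseudomanifold and $\mathcal L_1:\widetilde X_1\to X$, $\mathcal L_2:\widetilde X_2\to X$ are primary unfoldings of $X$, then there is a diffeomorphism $\varphi:\widetilde X_1\to\widetilde X_2$ with $\mathcal L_2\circ\varphi=\mathcal L_1$.
   Context: Manifolds are $C^\infty$ and without boundary. Simple space: a second countable metric topological space $X=R\sqcup\Sigma$, a disjoint union of two manifolds (with the induced topology), with $R$ (the regular part) open and dense and $\Sigma$ (the singular part) closed. A singular stratum is a connected component of $\Sigma$. A morphism $f:X\to X'$ is a continuous map with $f(R)\subset R'$, $f(\Sigma)\subset\Sigma'$, both restrictions being smooth. An embedding is a morphism that is an isomorphism (homeomorphism restricting to diffeomorphisms of regular and singular parts) onto its image, the image being a simple space with the induced decomposition. Cone: for a compact manifold $L$, $c(L)=L\times[0,\infty)/\!\sim$ with $(l,0)\sim(l',0)$ for all $l,l'$; the class of $(l,r)$ is $[l,r]$ and $v=[l,0]$ is the vertex. For a manifold $U$, $U\times c(L)$ is a simple space with regular part $U\times L\times(0,\infty)$ and singular part $U\times\{v\}$. Simple pseudomanifold (spm): a simple space $X$ such that every $x\in\Sigma$ has an open neighborhood that is the image of an embedding $\alpha:U\times c(L)\to X$ (a chart), with $U$ an open neighborhood of $x$ in its stratum $S$, $\alpha(u,v)=u$, and $L$ a compact manifold (the link of $S$) depending only on $S$. Links are assumed connected. Tubular neighborhood of a singular stratum $S$ with link $L$: a fiber bundle $\tau:T\to S$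 with fiber $c(L)$ such that $T$ is an open neighborhood of $S$ in $X$, $\tau(x)=x$ for $x\in S$, and for bundle charts $(U,\alpha),(V,\beta)$ (which are charts of $X$) with $U\cap V\neq\emptyset$, $\beta^{-1}\alpha(u,[l,r])=(u,[g_{\alpha\beta}(u)(l),r])$ with each $g_{\alpha\beta}(u)$ a diffeomorphism of $L$, smooth in $(u,l)$. A Thom-Mather spm is an spm in which every singular stratum has a tubular neighborhood. Unfolding of an spm $X$: a manifold $\widetilde X$ with a continuous proper map $\mathcal L:\widetilde X\to X$ such that (1) $\mathcal L:\mathcal L^{-1}(R)\to R$ is a smooth trivial covering; (2) for each $z\in\mathcal L^{-1}(\Sigma)$ there are a chart $\alpha:U\times c(L)\to X$ at $\mathcal L(z)$ and a diffeomorphism $\widetilde\alpha$ from $U\times L\times\mathbb R$ onto $\mathcal L^{-1}(\mathrm{Im}\,\alpha)$ with $\mathcal L\widetilde\alpha=\alpha c$, where $c(u,l,t)=(u,[l,|t|])$. It is primary if $\mathcal L^{-1}(R)=R_0\sqcup R_1$ is the union of exactly two diffeomorphic copies of $R$, i.e. a smooth trivial double covering of $R$. A bubble of $\widetilde X$ is a connected component of $\mathcal L^{-1}(R)$; uniqueness up to bubble labeling means that $\varphi$ may depend on which bubbles of $\widetilde X_1$ are matched with which bubbles of $\widetilde X_2$.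
   Formalization: The charts in condition (2) of both unfoldings are required to be bundle charts of one common choice of tubular neighborhoods of the singular strata; with arbitrary charts uniqueness fails, e.g. on c(S^1) with the chart [l,r] ↦ [l e^{i ln r}, r]. *)

theory Defs
  imports "HOL-Analysis.Analysis"
begin

section \<open>Smooth maps between subsets of Euclidean spaces\<close>

primrec Ck_on :: "nat \<Rightarrow> 'e::euclidean_space set \<Rightarrow> ('e \<Rightarrow> 'f::euclidean_space) \<Rightarrow> bool" where
  "Ck_on 0 W f \<longleftrightarrow> continuous_on W f"
| "Ck_on (Suc k) W f \<longleftrightarrow>
     (\<forall>x\<in>W. f differentiable (at x)) \<and>
     (\<forall>v. Ck_on k W (\<lambda>x. frechet_derivative f (at x) v))"

text \<open>On an arbitrary set, smooth means locally the restriction of a \<open>C\<^sup>\<infinity>\<close> map defined on an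
  open set. On a relatively open subset of a linear subspace this is the usual notion.\<close>

definition smooth_on :: "'e::euclidean_space set \<Rightarrow> ('e \<Rightarrow> 'f::euclidean_space) \<Rightarrow> bool" where
  "smooth_on A f \<longleftrightarrow>
     (\<forall>x\<in>A. \<exists>W F. open W \<and> x \<in> W \<and> (\<forall>k. Ck_on k W F) \<and> (\<forall>y\<in>W \<inter> A. F y = f y))"


section \<open>Smooth manifolds\<close>

text \<open>Charts take values in open subsets of linear subspaces of the model space. This allows
  dimension 0 and components of different dimensions.\<close>

record ('a, 'e) mfd =
  mtop :: "'a topology"
  atlas :: "('a set \<times> ('a \<Rightarrow> 'e)) set"

abbreviation mcarrier :: "('a, 'e) mfd \<Rightarrow> 'a set" where
  "mcarrier M \<equiv> topspace (mtop M)"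

definition manifold :: "('a, 'e::euclidean_space) mfd \<Rightarrow> bool" where
  "manifold M \<longleftrightarrow>
     Hausdorff_space (mtop M) \<and> second_countable (mtop M) \<and>
     (\<forall>(D, \<phi>)\<in>atlas M.
        openin (mtop M) D \<and>
        (\<exists>V. subspace V \<and> openin (top_of_set V) (\<phi> ` D)) \<and>
        homeomorphic_map (subtopology (mtop M) D) (top_of_set (\<phi> ` D)) \<phi>) \<and>
     (\<forall>x\<in>mcarrier M. \<exists>(D, \<phi>)\<in>atlas M. x \<in> D) \<and>
     (\<forall>(D, \<phi>)\<in>atlas M. \<forall>(E, \<psi>)\<in>atlas M.
        smooth_on (\<phi> ` (D \<inter> E)) (\<psi> \<circ> inv_into D \<phi>))"

definition smooth_map ::
  "('a, 'e::euclidean_space) mfd \<Rightarrow> ('b, 'f::euclidean_space) mfd \<Rightarrow> ('a \<Rightarrow> 'b) \<Rightarrow> bool" where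
  "smooth_map M N f \<longleftrightarrow>
     continuous_map (mtop M) (mtop N) f \<and>
     (\<forall>(D, \<phi>)\<in>atlas M. \<forall>(E, \<psi>)\<in>atlas N.
        smooth_on (\<phi> ` {x\<in>D. f x \<in> E}) (\<psi> \<circ> f \<circ> inv_into D \<phi>))"

definition diffeomorphism ::
  "('a, 'e::euclidean_space) mfd \<Rightarrow> ('b, 'f::euclidean_space) mfd \<Rightarrow> ('a \<Rightarrow> 'b) \<Rightarrow> bool" where
  "diffeomorphism M N f \<longleftrightarrow>
     smooth_map M N f \<and>
     (\<exists>g. smooth_map N M g \<and>
          (\<forall>x\<in>mcarrier M. g (f x) = x) \<and> (\<forall>y\<in>mcarrier N. f (g y) = y))"

definition open_submfd :: "('a, 'e) mfd \<Rightarrow> 'a set \<Rightarrow> ('a, 'e) mfd" where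
  "open_submfd M W =
     \<lparr>mtop = subtopology (mtop M) W, atlas = {(D \<inter> W, \<phi>) |D \<phi>. (D, \<phi>) \<in> atlas M}\<rparr>"

definition prod_mfd :: "('a, 'e) mfd \<Rightarrow> ('b, 'f) mfd \<Rightarrow> ('a \<times> 'b, 'e \<times> 'f) mfd" where
  "prod_mfd M N =
     \<lparr>mtop = prod_topology (mtop M) (mtop N),
      atlas = {(D \<times> E, map_prod \<phi> \<psi>) |D \<phi> E \<psi>. (D, \<phi>) \<in> atlas M \<and> (E, \<psi>) \<in> atlas N}\<rparr>"

definition real_mfd :: "(real, real) mfd" where
  "real_mfd = \<lparr>mtop = euclideanreal, atlas = {(UNIV, id)}\<rparr>"

definition quotient_topology :: "'a topology \<Rightarrow> ('a \<Rightarrow> 'b) \<Rightarrow> 'b topology" where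
  "quotient_topology X f =
     topology (\<lambda>U. U \<subseteq> f ` topspace X \<and> openin X {x\<in>topspace X. f x \<in> U})"

lemma openin_quotient_topology:
  "openin (quotient_topology X f) U \<longleftrightarrow>
     U \<subseteq> f ` topspace X \<and> openin X {x\<in>topspace X. f x \<in> U}"
proof -
  let ?P = "\<lambda>U. U \<subseteq> f ` topspace X \<and> openin X {x\<in>topspace X. f x \<in> U}"
  have "istopology ?P"
    unfolding istopology_def
  proof (intro conjI allI impI)
    fix S T assume S: "?P S" and T: "?P T"
    have "{x\<in>topspace X. f x \<in> S \<inter> T} = {x\<in>topspace X. f x \<in> S} \<inter> {x\<in>topspace X. f x \<in> T}"
      by auto
    then show "openin X {x\<in>topspace X. f x \<in> S \<inter> T}"
      using S T by (simp add: openin_Int)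
    show "S \<inter> T \<subseteq> f ` topspace X" using S by blast
  next
    fix \<K> assume K: "\<forall>K\<in>\<K>. ?P K"
    have "{x\<in>topspace X. f x \<in> \<Union>\<K>} = (\<Union>K\<in>\<K>. {x\<in>topspace X. f x \<in> K})"
      by auto
    then show "openin X {x\<in>topspace X. f x \<in> \<Union>\<K>}"
      using K by auto
    show "\<Union>\<K> \<subseteq> f ` topspace X" using K by blast
  qed
  then show ?thesis
    by (simp add: quotient_topology_def)
qed

lemma topspace_quotient_topology: "topspace (quotient_topology X f) = f ` topspace X"
proof -
  have "{x \<in> topspace X. f x \<in> f ` topspace X} = topspace X" by auto
  then have "openin (quotient_topology X f) (f ` topspace X)"
    by (simp add: openin_quotient_topology)
  moreover have "topspace (quotient_topology X f) \<subseteq> f ` topspace X"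
    using openin_quotient_topology[of X f "topspace (quotient_topology X f)"] by simp
  ultimately show ?thesis by (meson openin_subset subset_antisym)
qed

text \<open>The manifold structure carried along a map that is injective on \<open>M\<close>.\<close>

definition transport_mfd :: "('a, 'e) mfd \<Rightarrow> ('a \<Rightarrow> 'b) \<Rightarrow> ('b, 'e) mfd" where
  "transport_mfd M f =
     \<lparr>mtop = quotient_topology (mtop M) f,
      atlas = {(f ` D, \<phi> \<circ> inv_into (mcarrier M) f) |D \<phi>. (D, \<phi>) \<in> atlas M}\<rparr>"


section \<open>Simple spaces\<close>

record ('a, 'r, 's) sspace =
  space_top :: "'a topology"
  regular :: "('a, 'r) mfd"
  singular :: "('a, 's) mfd"

definition simple_space ::
  "('a, 'r::euclidean_space, 's::euclidean_space) sspace \<Rightarrow> bool" where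
  "simple_space X \<longleftrightarrow>
     metrizable_space (space_top X) \<and> second_countable (space_top X) \<and>
     manifold (regular X) \<and> manifold (singular X) \<and>
     mcarrier (regular X) \<union> mcarrier (singular X) = topspace (space_top X) \<and>
     mcarrier (regular X) \<inter> mcarrier (singular X) = {} \<and>
     mtop (regular X) = subtopology (space_top X) (mcarrier (regular X)) \<and>
     mtop (singular X) = subtopology (space_top X) (mcarrier (singular X)) \<and>
     openin (space_top X) (mcarrier (regular X)) \<and>
     space_top X closure_of mcarrier (regular X) = topspace (space_top X) \<and>
     closedin (space_top X) (mcarrier (singular X))"

definition singular_strata :: "('a, 'r, 's) sspace \<Rightarrow> 'a set set" where
  "singular_strata X = connected_components_of (mtop (singular X))"

definition simple_morphism ::
  "('a, 'r::euclidean_space, 's::euclidean_space) sspace \<Rightarrow>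
   ('b, 'p::euclidean_space, 'q::euclidean_space) sspace \<Rightarrow> ('a \<Rightarrow> 'b) \<Rightarrow> bool" where
  "simple_morphism X Y f \<longleftrightarrow>
     continuous_map (space_top X) (space_top Y) f \<and>
     f ` mcarrier (regular X) \<subseteq> mcarrier (regular Y) \<and>
     f ` mcarrier (singular X) \<subseteq> mcarrier (singular Y) \<and>
     smooth_map (regular X) (regular Y) f \<and>
     smooth_map (singular X) (singular Y) f"

definition simple_iso ::
  "('a, 'r::euclidean_space, 's::euclidean_space) sspace \<Rightarrow>
   ('b, 'p::euclidean_space, 'q::euclidean_space) sspace \<Rightarrow> ('a \<Rightarrow> 'b) \<Rightarrow> bool" where
  "simple_iso X Y f \<longleftrightarrow>
     homeomorphic_map (space_top X) (space_top Y) f \<and>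
     diffeomorphism (regular X) (regular Y) f \<and>
     diffeomorphism (singular X) (singular Y) f"

definition open_subsspace :: "('a, 'r, 's) sspace \<Rightarrow> 'a set \<Rightarrow> ('a, 'r, 's) sspace" where
  "open_subsspace X W =
     \<lparr>space_top = subtopology (space_top X) W,
      regular = open_submfd (regular X) W,
      singular = open_submfd (singular X) W\<rparr>"

text \<open>Only embeddings with open image are needed. The image is then a simple space with the
  induced decomposition.\<close>

definition open_embedding ::
  "('a, 'r::euclidean_space, 's::euclidean_space) sspace \<Rightarrow>
   ('b, 'p::euclidean_space, 'q::euclidean_space) sspace \<Rightarrow> ('a \<Rightarrow> 'b) \<Rightarrow> bool" where
  "open_embedding X Y f \<longleftrightarrow>
     simple_morphism X Y f \<and>
     openin (space_top Y) (f ` topspace (space_top X)) \<and>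
     simple_iso X (open_subsspace Y (f ` topspace (space_top X))) f"


section \<open>Cones\<close>

text \<open>The class \<open>[l, r]\<close> is represented as the set of pairs equivalent to \<open>(l, r)\<close>.\<close>

definition cone_vertex :: "('l, 'k) mfd \<Rightarrow> ('l \<times> real) set" where
  "cone_vertex L = mcarrier L \<times> {0}"

definition cone_pt :: "('l, 'k) mfd \<Rightarrow> 'l \<Rightarrow> real \<Rightarrow> ('l \<times> real) set" where
  "cone_pt L l r = (if r = 0 then cone_vertex L else {(l, r)})"

definition cone_top :: "('l, 'k) mfd \<Rightarrow> ('l \<times> real) set topology" where
  "cone_top L =
     quotient_topology (prod_topology (mtop L) (top_of_set {0..})) (\<lambda>(l, r). cone_pt L l r)"

definition cone_bundle ::
  "('u, 's) mfd \<Rightarrow> ('l, 'k) mfd \<Rightarrow>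
   ('u \<times> ('l \<times> real) set, 's \<times> 'k \<times> real, 's) sspace" where
  "cone_bundle U L =
     \<lparr>space_top = prod_topology (mtop U) (cone_top L),
      regular = transport_mfd (prod_mfd U (prod_mfd L (open_submfd real_mfd {0<..})))
                  (\<lambda>(u, l, r). (u, cone_pt L l r)),
      singular = transport_mfd U (\<lambda>u. (u, cone_vertex L))\<rparr>"


section \<open>Simple pseudomanifolds\<close>

text \<open>The argument \<open>Lk\<close> assigns to each singular stratum its link.\<close>

definition cone_chart ::
  "('a, 'r::euclidean_space, 's::euclidean_space) sspace \<Rightarrow>
   ('a set \<Rightarrow> ('l, 'k::euclidean_space) mfd) \<Rightarrow> 'a set \<Rightarrow>
   'a set \<Rightarrow> ('a \<times> ('l \<times> real) set \<Rightarrow> 'a) \<Rightarrow> bool" where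
  "cone_chart X Lk S U \<alpha> \<longleftrightarrow>
     openin (subtopology (space_top X) S) U \<and>
     open_embedding (cone_bundle (open_submfd (singular X) U) (Lk S)) X \<alpha> \<and>
     (\<forall>u\<in>U. \<alpha> (u, cone_vertex (Lk S)) = u)"

definition chart_image ::
  "('l, 'k) mfd \<Rightarrow> 'a set \<Rightarrow> ('a \<times> ('l \<times> real) set \<Rightarrow> 'a) \<Rightarrow> 'a set" where
  "chart_image L U \<alpha> = \<alpha> ` (U \<times> topspace (cone_top L))"

definition simple_pseudomanifold ::
  "('a, 'r::euclidean_space, 's::euclidean_space) sspace \<Rightarrow>
   ('a set \<Rightarrow> ('l, 'k::euclidean_space) mfd) \<Rightarrow> bool" where
  "simple_pseudomanifold X Lk \<longleftrightarrow>
     simple_space X \<and>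
     (\<forall>S\<in>singular_strata X.
        manifold (Lk S) \<and> compact_space (mtop (Lk S)) \<and> connected_space (mtop (Lk S)) \<and>
        (\<forall>x\<in>S. \<exists>U \<alpha>. x \<in> U \<and> cone_chart X Lk S U \<alpha>))"


section \<open>Tubular neighborhoods\<close>

record ('a, 'l) tube =
  tube_set :: "'a set"
  tube_proj :: "'a \<Rightarrow> 'a"
  tube_charts :: "('a set \<times> ('a \<times> ('l \<times> real) set \<Rightarrow> 'a)) set"

definition tubular_neighborhood ::
  "('a, 'r::euclidean_space, 's::euclidean_space) sspace \<Rightarrow>
   ('a set \<Rightarrow> ('l, 'k::euclidean_space) mfd) \<Rightarrow> 'a set \<Rightarrow> ('a, 'l) tube \<Rightarrow> bool" where
  "tubular_neighborhood X Lk S \<T> \<longleftrightarrow>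
     openin (space_top X) (tube_set \<T>) \<and> S \<subseteq> tube_set \<T> \<and>
     continuous_map (subtopology (space_top X) (tube_set \<T>)) (subtopology (space_top X) S)
       (tube_proj \<T>) \<and>
     (\<forall>x\<in>S. tube_proj \<T> x = x) \<and>
     (\<forall>x\<in>S. \<exists>(U, \<alpha>)\<in>tube_charts \<T>. x \<in> U) \<and>
     (\<forall>(U, \<alpha>)\<in>tube_charts \<T>.
        cone_chart X Lk S U \<alpha> \<and>
        chart_image (Lk S) U \<alpha> = {x\<in>tube_set \<T>. tube_proj \<T> x \<in> U} \<and>
        (\<forall>u\<in>U. \<forall>p\<in>topspace (cone_top (Lk S)). tube_proj \<T> (\<alpha> (u, p)) = u)) \<and>
     (\<forall>(U, \<alpha>)\<in>tube_charts \<T>. \<forall>(V, \<beta>)\<in>tube_charts \<T>. U \<inter> V \<noteq> {} \<longrightarrow>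
        (\<exists>g. (\<forall>u\<in>U \<inter> V. diffeomorphism (Lk S) (Lk S) (g u)) \<and>
             smooth_map (prod_mfd (open_submfd (singular X) (U \<inter> V)) (Lk S)) (Lk S)
               (\<lambda>(u, l). g u l) \<and>
             (\<forall>u\<in>U \<inter> V. \<forall>l\<in>mcarrier (Lk S). \<forall>r\<ge>0.
                \<alpha> (u, cone_pt (Lk S) l r) = \<beta> (u, cone_pt (Lk S) (g u l) r))))"

text \<open>\<open>Tb\<close> assigns to each singular stratum a tubular neighborhood.\<close>

definition thom_mather_spm ::
  "('a, 'r::euclidean_space, 's::euclidean_space) sspace \<Rightarrow>
   ('a set \<Rightarrow> ('l, 'k::euclidean_space) mfd) \<Rightarrow> ('a set \<Rightarrow> ('a, 'l) tube) \<Rightarrow> bool" where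
  "thom_mather_spm X Lk Tb \<longleftrightarrow>
     simple_pseudomanifold X Lk \<and>
     (\<forall>S\<in>singular_strata X. tubular_neighborhood X Lk S (Tb S))"


section \<open>Unfoldings\<close>

definition smooth_trivial_covering ::
  "('a, 'e::euclidean_space) mfd \<Rightarrow> ('b, 'f::euclidean_space) mfd \<Rightarrow> ('a \<Rightarrow> 'b) \<Rightarrow>
   'a set set \<Rightarrow> bool" where
  "smooth_trivial_covering M N p \<W> \<longleftrightarrow>
     \<W> \<noteq> {} \<and> pairwise disjnt \<W> \<and> \<Union>\<W> = mcarrier M \<and>
     (\<forall>W\<in>\<W>. openin (mtop M) W \<and> diffeomorphism (open_submfd M W) N p)"

definition preim :: "('b, 'e) mfd \<Rightarrow> ('b \<Rightarrow> 'a) \<Rightarrow> 'a set \<Rightarrow> 'b set" where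
  "preim M f A = {z\<in>mcarrier M. f z \<in> A}"

text \<open>\<open>Ch S\<close> is the set of admissible charts at points of the stratum \<open>S\<close>: all pairs \<open>(U, \<alpha>)\<close> with
  \<open>cone_chart X Lk S U \<alpha>\<close> for a bare simple pseudomanifold \<open>X\<close>, and the bundle charts of the
  tubular neighborhood of \<open>S\<close> for a Thom-Mather simple pseudomanifold. In the second case the
  restriction cannot be dropped if unfoldings are to be unique: on the cone of the circle
  \<open>{z::complex. norm z = 1}\<close> the map \<open>[l, r] \<mapsto> [l * cis (ln r), r]\<close> fixing the vertex is a
  \<open>cone_chart\<close>, and the unfolding it defines is not isomorphic to the one defined by the
  identity chart.\<close>

definition unfolding_with ::
  "('a, 'r::euclidean_space, 's::euclidean_space) sspace \<Rightarrow>
   ('a set \<Rightarrow> ('l, 'k::euclidean_space) mfd) \<Rightarrow>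
   ('a set \<Rightarrow> ('a set \<times> ('a \<times> ('l \<times> real) set \<Rightarrow> 'a)) set) \<Rightarrow>
   ('b, 'e::euclidean_space) mfd \<Rightarrow> ('b \<Rightarrow> 'a) \<Rightarrow> bool" where
  "unfolding_with X Lk Ch Xt \<L> \<longleftrightarrow>
     manifold Xt \<and>
     continuous_map (mtop Xt) (space_top X) \<L> \<and> proper_map (mtop Xt) (space_top X) \<L> \<and>
     (\<exists>\<W>. smooth_trivial_covering (open_submfd Xt (preim Xt \<L> (mcarrier (regular X))))
             (regular X) \<L> \<W>) \<and>
     (\<forall>z\<in>preim Xt \<L> (mcarrier (singular X)).
        \<exists>S\<in>singular_strata X. \<exists>(U, \<alpha>)\<in>Ch S. \<exists>\<alpha>t.
          \<L> z \<in> U \<and> cone_chart X Lk S U \<alpha> \<and>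
          diffeomorphism
            (prod_mfd (open_submfd (singular X) U) (prod_mfd (Lk S) real_mfd))
            (open_submfd Xt (preim Xt \<L> (chart_image (Lk S) U \<alpha>))) \<alpha>t \<and>
          (\<forall>u\<in>U. \<forall>l\<in>mcarrier (Lk S). \<forall>t.
             \<L> (\<alpha>t (u, l, t)) = \<alpha> (u, cone_pt (Lk S) l \<bar>t\<bar>)))"

definition unfolding_of ::
  "('a, 'r::euclidean_space, 's::euclidean_space) sspace \<Rightarrow>
   ('a set \<Rightarrow> ('l, 'k::euclidean_space) mfd) \<Rightarrow>
   ('b, 'e::euclidean_space) mfd \<Rightarrow> ('b \<Rightarrow> 'a) \<Rightarrow> bool" where
  "unfolding_of X Lk Xt \<L> \<longleftrightarrow>
     unfolding_with X Lk (\<lambda>S. {(U, \<alpha>). cone_chart X Lk S U \<alpha>}) Xt \<L>"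

definition thom_mather_unfolding ::
  "('a, 'r::euclidean_space, 's::euclidean_space) sspace \<Rightarrow>
   ('a set \<Rightarrow> ('l, 'k::euclidean_space) mfd) \<Rightarrow> ('a set \<Rightarrow> ('a, 'l) tube) \<Rightarrow>
   ('b, 'e::euclidean_space) mfd \<Rightarrow> ('b \<Rightarrow> 'a) \<Rightarrow> bool" where
  "thom_mather_unfolding X Lk Tb Xt \<L> \<longleftrightarrow>
     unfolding_with X Lk (\<lambda>S. tube_charts (Tb S)) Xt \<L>"

lemma thom_mather_unfolding_imp_unfolding_of:
  assumes "thom_mather_unfolding X Lk Tb Xt \<L>"
  shows "unfolding_of X Lk Xt \<L>"
proof -
  have *: "\<exists>(U, \<alpha>)\<in>{(U, \<alpha>). C U \<alpha>}. \<exists>a. Q U \<and> C U \<alpha> \<and> H U \<alpha> a"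
    if "\<exists>(U, \<alpha>)\<in>B. \<exists>a. Q U \<and> C U \<alpha> \<and> H U \<alpha> a" for B C Q H
    using that by auto
  show ?thesis
    using assms
    unfolding thom_mather_unfolding_def unfolding_of_def unfolding_with_def
    apply (elim conjE)
    apply (intro conjI ballI)
        apply assumption+
    apply (drule (1) bspec)
    apply (erule bexE)
    apply (rule bexI)
     apply (rule *)
     apply assumption+
    done
qed

definition primary_unfolding ::
  "('a, 'r::euclidean_space, 's::euclidean_space) sspace \<Rightarrow>
   ('a set \<Rightarrow> ('l, 'k::euclidean_space) mfd) \<Rightarrow> ('a set \<Rightarrow> ('a, 'l) tube) \<Rightarrow>
   ('b, 'e::euclidean_space) mfd \<Rightarrow> ('b \<Rightarrow> 'a) \<Rightarrow> bool" where
  "primary_unfolding X Lk Tb Xt \<L> \<longleftrightarrow>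
     thom_mather_unfolding X Lk Tb Xt \<L> \<and>
     (\<exists>R0 R1. disjnt R0 R1 \<and>
        smooth_trivial_covering (open_submfd Xt (preim Xt \<L> (mcarrier (regular X))))
          (regular X) \<L> {R0, R1})"

end

theory Submission
  imports Defs
begin

text \<open>Label the bubbles of both unfoldings. On the regular part \<open>\<phi>\<close> is forced: it is the inverse of
  \<open>L2\<close> on a bubble after \<open>L1\<close> on the bubble with the same label. Near a point over a singular
  stratum, choose folded bundle charts of both unfoldings. There \<open>\<phi>\<close> is
  \<open>(u, l, t) \<mapsto> (u, g u l, t)\<close> or \<open>(u, l, t) \<mapsto> (u, g u l, - t)\<close>, where \<open>g\<close> is the transition of the
  two tubular charts; the sign compares the labels of the half \<open>t > 0\<close> and is locally constant since
  the link is connected. Both formulas are smooth across \<open>t = 0\<close>. Since the regular part is dense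
  and the unfoldings are Hausdorff, the local extensions agree, and the map constructed the other way
  round is an inverse.\<close>

section \<open>Calculus of \<open>C\<^sup>k\<close> maps\<close>

text \<open>On each bubble the lift is determined, so everything turns on what happens over a
  singular stratum. The transition \<open>g\<close> of two tubular charts does not depend on the
  radius; hence in folded coordinates the lift is linear in \<open>t\<close>, and the absolute value
  in the fold leaves only the sign of \<open>t\<close> open. A transition that varies with the
  radius, such as rotation by \<open>ln r\<close>, could fail to have a limit at
  \<open>t = 0\<close>. The unfolding axiom provides folded charts only at points of the unfolding.
  Before two of them can be compared, the second unfolding must be shown to have a point over the
  given singular point: properness makes its image closed, and the image contains the dense regular
  part. Lifts are shown to be smooth, never directly to be local diffeomorphisms. Exchanging the
  unfoldings gives a lift back, whose smoothness rests on the tubular transition in the opposite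
  direction, and matching labels force the composites to be identities. Since lifts are built
  locally and then glued, smoothness is treated as a property of germs and turned into
  \<open>smooth_map\<close> only at the end.\<close>

lemma Ck_on_subset: "Ck_on k W f \<Longrightarrow> V \<subseteq> W \<Longrightarrow> Ck_on k V f"
  by (induction k arbitrary: f) (auto intro: continuous_on_subset)

text \<open>\<open>Ck_on\<close> uses full derivatives \<open>at x\<close>. Agreement on
  \<open>W\<close> determines them because the open set \<open>W\<close> is a neighborhood of each
  of its points.\<close>

lemma Ck_on_cong:
  assumes "open W" "\<And>x. x \<in> W \<Longrightarrow> f x = g x" "Ck_on k W f"
  shows "Ck_on k W g"
  using assms(2,3)
proof (induction k arbitrary: f g)
  case 0
  then show ?case by (simp cong: continuous_on_cong)
next
  case (Suc k)
  have d: "(g has_derivative frechet_derivative f (at x)) (at x)" if "x \<in> W" for x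
    by (rule has_derivative_transform_within_open[OF _ assms(1) that Suc.prems(1)])
      (use Suc.prems(2) that in \<open>auto simp: frechet_derivative_works\<close>)
  then have "frechet_derivative f (at x) = frechet_derivative g (at x)" if "x \<in> W" for x
    using frechet_derivative_at that by blast
  then have "Ck_on k W (\<lambda>x. frechet_derivative g (at x) v)" for v
    using Suc.IH[of "\<lambda>x. frechet_derivative f (at x) v" "\<lambda>x. frechet_derivative g (at x) v"]
      Suc.prems(2) by simp
  then show ?case using d by (auto simp: differentiable_def)
qed

text \<open>The definition refers to the chosen derivative \<open>frechet_derivative\<close>.
  Derivatives at a point are unique, so an explicit formula for the derivative can be used
  instead.\<close>

lemma Ck_on_SucI:
  assumes "open W" "\<And>x. x \<in> W \<Longrightarrow> (f has_derivative f' x) (at x)"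
    "\<And>v. Ck_on k W (\<lambda>x. f' x v)"
  shows "Ck_on (Suc k) W f"
proof -
  have "f' x = frechet_derivative f (at x)" if "x \<in> W" for x
    using frechet_derivative_at assms(2) that by blast
  then have "Ck_on k W (\<lambda>x. frechet_derivative f (at x) v)" for v
    using Ck_on_cong[OF assms(1) _ assms(3)[of v]] by simp
  then show ?thesis using assms(2) by (auto simp: differentiable_def)
qed

lemma Ck_on_Suc_derivative:
  "Ck_on (Suc k) W f \<Longrightarrow> x \<in> W \<Longrightarrow> (f has_derivative frechet_derivative f (at x)) (at x)"
  by (simp add: frechet_derivative_works)

lemma Ck_on_SucD: "Ck_on (Suc k) W f \<Longrightarrow> Ck_on k W f"
proof (induction k arbitrary: f)
  case 0
  then show ?case
    by (simp add: continuous_at_imp_continuous_on differentiable_imp_continuous_within)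
qed auto

lemma Ck_on_continuous: "Ck_on k W f \<Longrightarrow> continuous_on W f"
  by (induction k) (use Ck_on_SucD in auto)

lemma Ck_on_const: "open W \<Longrightarrow> Ck_on k W (\<lambda>x. c)"
proof (induction k arbitrary: c)
  case (Suc k)
  then show ?case by (intro Ck_on_SucI[where f' = "\<lambda>_ _. 0"]) auto
qed auto

lemma Ck_on_linear:
  assumes "open W" "bounded_linear f"
  shows "Ck_on k W f"
proof (cases k)
  case 0
  then show ?thesis using assms by (simp add: linear_continuous_on)
next
  case (Suc m)
  show ?thesis unfolding Suc
    by (rule Ck_on_SucI[where f' = "\<lambda>_. f"])
      (use assms in \<open>auto intro: bounded_linear_imp_has_derivative Ck_on_const\<close>)
qed

lemma Ck_on_add:
  assumes "open W" "Ck_on k W f" "Ck_on k W g"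
  shows "Ck_on k W (\<lambda>x. f x + g x)"
  using assms(2,3)
proof (induction k arbitrary: f g)
  case 0
  then show ?case by (simp add: continuous_on_add)
next
  case (Suc k)
  show ?case
    by (rule Ck_on_SucI[OF assms(1) has_derivative_add[OF Ck_on_Suc_derivative[OF Suc.prems(1)]
            Ck_on_Suc_derivative[OF Suc.prems(2)]]])
      (use Suc in auto)
qed

lemma Ck_on_sum:
  assumes "open W" "\<And>i. i \<in> I \<Longrightarrow> Ck_on k W (f i)"
  shows "Ck_on k W (\<lambda>x. \<Sum>i\<in>I. f i x)"
  using assms(2)
  by (induction I rule: infinite_finite_induct) (auto intro: Ck_on_const Ck_on_add assms(1))

lemma Ck_on_scaleR:
  assumes "open W" "Ck_on k W f" "Ck_on k W g"
  shows "Ck_on k W (\<lambda>x. f x *\<^sub>R g x)"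
  using assms(2,3)
proof (induction k arbitrary: f g)
  case 0
  then show ?case by (simp add: continuous_on_scaleR)
next
  case (Suc k)
  show ?case
    by (rule Ck_on_SucI[OF assms(1) has_derivative_scaleR[OF Ck_on_Suc_derivative[OF Suc.prems(1)]
            Ck_on_Suc_derivative[OF Suc.prems(2)]]])
      (use Suc Suc.prems[THEN Ck_on_SucD] in \<open>auto intro!: Ck_on_add[OF assms(1)]\<close>)
qed

lemma Ck_on_Pair:
  assumes "open W" "Ck_on k W f" "Ck_on k W g"
  shows "Ck_on k W (\<lambda>x. (f x, g x))"
  using assms(2,3)
proof (induction k arbitrary: f g)
  case 0
  then show ?case by (simp add: continuous_on_Pair)
next
  case (Suc k)
  show ?case
    by (rule Ck_on_SucI[OF assms(1) has_derivative_Pair[OF Ck_on_Suc_derivative[OF Suc.prems(1)]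
            Ck_on_Suc_derivative[OF Suc.prems(2)]]])
      (use Suc in auto)
qed

lemma Ck_on_compose:
  fixes f :: "'a::euclidean_space \<Rightarrow> 'b::euclidean_space"
  assumes "open W" "open V" "f ` W \<subseteq> V" "Ck_on k W f" "Ck_on k V g"
  shows "Ck_on k W (\<lambda>x. g (f x))"
  using assms(4,5)
proof (induction k arbitrary: g)
  case 0
  then show ?case using assms(3) continuous_on_compose2 by auto
next
  case (Suc k)
  let ?f' = "\<lambda>x. frechet_derivative f (at x)" and ?g' = "\<lambda>x. frechet_derivative g (at x)"
  have df: "(f has_derivative ?f' x) (at x)" and dg: "(g has_derivative ?g' (f x)) (at (f x))"
    if "x \<in> W" for x
    using Ck_on_Suc_derivative[OF Suc.prems(1) that] Ck_on_Suc_derivative[OF Suc.prems(2)]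
      assms(3) that by auto
  show ?case
  proof (rule Ck_on_SucI[OF assms(1), where f' = "\<lambda>x v. ?g' (f x) (?f' x v)"])
    show "((\<lambda>x. g (f x)) has_derivative (\<lambda>v. ?g' (f x) (?f' x v))) (at x)" if "x \<in> W" for x
      using has_derivative_compose[OF df dg] that by blast
    fix v
    \<comment> \<open>The induction hypothesis covers \<open>?g' (f x) w\<close> for a constant
      vector \<open>w\<close>, but here the vector moves with \<open>x\<close>. Expanding it in
      \<open>Basis\<close> leaves constant vectors with scalar coefficients.\<close>
    have "?g' (f x) (?f' x v) = (\<Sum>b\<in>Basis. (?f' x v \<bullet> b) *\<^sub>R ?g' (f x) b)" if "x \<in> W" for x
    proof -
      interpret bounded_linear "?g' (f x)" using dg[OF that] by (rule has_derivative_bounded_linear)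
      have "?g' (f x) (\<Sum>b\<in>Basis. (?f' x v \<bullet> b) *\<^sub>R b) = (\<Sum>b\<in>Basis. (?f' x v \<bullet> b) *\<^sub>R ?g' (f x) b)"
        by (simp add: sum scaleR)
      then show ?thesis by (simp add: euclidean_representation)
    qed
    moreover have "Ck_on k W (\<lambda>x. \<Sum>b\<in>Basis. (?f' x v \<bullet> b) *\<^sub>R ?g' (f x) b)"
    proof (intro Ck_on_sum Ck_on_scaleR assms(1))
      fix b :: 'b
      \<comment> \<open>The induction keeps \<open>f\<close> fixed, so its hypothesis does not apply
        to the linear form \<open>b\<close> composed with the derivative of \<open>f\<close>; this
        needs its own induction.\<close>
      have inner: "Ck_on j W (\<lambda>x. h x \<bullet> b)" if "Ck_on j W h" for j and h :: "'a \<Rightarrow> 'b"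
        using that
      proof (induction j arbitrary: h)
        case 0
        then show ?case by (simp add: continuous_on_inner)
      next
        case (Suc j)
        show ?case
          by (rule Ck_on_SucI[OF assms(1) has_derivative_inner_left[OF Ck_on_Suc_derivative[OF Suc.prems]]])
            (use Suc in auto)
      qed
      show "Ck_on k W (\<lambda>x. ?f' x v \<bullet> b)" using Suc.prems(1) by (intro inner) simp
      show "Ck_on k W (\<lambda>x. ?g' (f x) b)"
        by (rule Suc.IH) (use Suc.prems Ck_on_SucD in auto)
    qed
    ultimately show "Ck_on k W (\<lambda>x. ?g' (f x) (?f' x v))"
      using Ck_on_cong[OF assms(1), of "\<lambda>x. \<Sum>b\<in>Basis. (?f' x v \<bullet> b) *\<^sub>R ?g' (f x) b"] by simp
  qed
qed

text \<open>Openness is part of the notion so that \<open>cinf_compose\<close> can shrink the domain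
  to where the composite makes sense, without an inclusion to be checked at each use.\<close>

definition cinf :: "'e::euclidean_space set \<Rightarrow> ('e \<Rightarrow> 'f::euclidean_space) \<Rightarrow> bool" where
  "cinf W F \<longleftrightarrow> open W \<and> (\<forall>k. Ck_on k W F)"

lemma cinf_compose:
  assumes "cinf W F" "cinf V G"
  shows "cinf (W \<inter> F -` V) (\<lambda>x. G (F x))"
proof -
  have *: "open W" "open V" "continuous_on W F"
    using assms unfolding cinf_def by (auto intro: Ck_on_continuous)
  then have o: "open (W \<inter> F -` V)" by (simp add: continuous_open_preimage)
  have "Ck_on k (W \<inter> F -` V) (\<lambda>x. G (F x))" for k
    by (rule Ck_on_compose[OF o *(2)]) (use assms Ck_on_subset[of k W F] in \<open>auto simp: cinf_def\<close>)
  with o show ?thesis by (simp add: cinf_def)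
qed

lemma cinf_Pair:
  assumes "cinf W F" "cinf V G"
  shows "cinf (W \<inter> V) (\<lambda>x. (F x, G x))"
  using assms Ck_on_subset[of _ W F "W \<inter> V"] Ck_on_subset[of _ V G "W \<inter> V"]
  by (simp add: cinf_def open_Int Ck_on_Pair)

lemma cinf_linear: "bounded_linear F \<Longrightarrow> cinf UNIV F"
  unfolding cinf_def by (simp add: Ck_on_linear)

lemma cinf_map_prod:
  assumes "cinf W F" "cinf V G"
  shows "cinf (W \<times> V) (map_prod F G)"
proof -
  have "cinf (UNIV \<inter> fst -` W \<inter> (UNIV \<inter> snd -` V)) (\<lambda>x. (F (fst x), G (snd x)))"
    using assms by (intro cinf_Pair cinf_compose cinf_linear bounded_linear_fst bounded_linear_snd)
  moreover have "UNIV \<inter> fst -` W \<inter> (UNIV \<inter> snd -` V) = W \<times> V" by auto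
  ultimately show ?thesis by (simp add: map_prod_def case_prod_unfold)
qed

section \<open>Germs of smooth maps between manifolds\<close>

text \<open>The part of \<open>manifold\<close> that \<open>open_submfd M W\<close> inherits for every set \<open>W\<close>, open or not. It spares
  a proof that strata are open in the singular part.\<close>

definition smooth_atlas :: "('a, 'e::euclidean_space) mfd \<Rightarrow> bool" where
  "smooth_atlas M \<longleftrightarrow>
     (\<forall>(D, \<phi>)\<in>atlas M. openin (mtop M) D \<and>
        homeomorphic_map (subtopology (mtop M) D) (top_of_set (\<phi> ` D)) \<phi>) \<and>
     (\<forall>x\<in>mcarrier M. \<exists>(D, \<phi>)\<in>atlas M. x \<in> D) \<and>
     (\<forall>(D, \<phi>)\<in>atlas M. \<forall>(E, \<psi>)\<in>atlas M. \<forall>x\<in>D \<inter> E.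
        \<exists>W F. cinf W F \<and> \<phi> x \<in> W \<and> (\<forall>y\<in>D \<inter> E. \<phi> y \<in> W \<longrightarrow> F (\<phi> y) = \<psi> y))"

text \<open>Since a chart is injective, a map on its image can be tested at points of the manifold.
  This removes \<open>inv_into\<close> and gives the form in which smoothness is used from here
  on.\<close>

lemma smooth_on_image_iff:
  assumes "inj_on \<phi> D" "A \<subseteq> D"
  shows "smooth_on (\<phi> ` A) (h \<circ> inv_into D \<phi>) \<longleftrightarrow>
    (\<forall>x\<in>A. \<exists>W F. cinf W F \<and> \<phi> x \<in> W \<and> (\<forall>y\<in>A. \<phi> y \<in> W \<longrightarrow> F (\<phi> y) = h y))"
proof -
  have [simp]: "inv_into D \<phi> (\<phi> y) = y" if "y \<in> A" for y
    using assms that by (auto intro: inv_into_f_f)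
  have "(\<forall>y\<in>W \<inter> \<phi> ` A. F y = (h \<circ> inv_into D \<phi>) y) \<longleftrightarrow> (\<forall>y\<in>A. \<phi> y \<in> W \<longrightarrow> F (\<phi> y) = h y)"
    for W F by auto
  then show ?thesis
    unfolding smooth_on_def cinf_def by (simp add: conj_ac)
qed

lemma homeomorphic_map_chart_inj:
  assumes "openin (mtop M) D" "homeomorphic_map (subtopology (mtop M) D) (top_of_set (\<phi> ` D)) \<phi>"
  shows "inj_on \<phi> D"
  using homeomorphic_imp_injective_map[OF assms(2)] openin_subset[OF assms(1)]
  by (simp add: Int_absorb1)

lemma manifold_imp_smooth_atlas:
  assumes "manifold M"
  shows "smooth_atlas M"
proof -
  have "\<exists>W F. cinf W F \<and> \<phi> x \<in> W \<and> (\<forall>y\<in>D \<inter> E. \<phi> y \<in> W \<longrightarrow> F (\<phi> y) = \<psi> y)"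
    if "(D, \<phi>) \<in> atlas M" "(E, \<psi>) \<in> atlas M" "x \<in> D \<inter> E" for D \<phi> E \<psi> x
  proof -
    have "inj_on \<phi> D"
      using assms that(1) unfolding manifold_def by (blast intro: homeomorphic_map_chart_inj)
    moreover have "smooth_on (\<phi> ` (D \<inter> E)) (\<psi> \<circ> inv_into D \<phi>)"
      using assms that unfolding manifold_def by blast
    ultimately show ?thesis using that(3) smooth_on_image_iff[of \<phi> D "D \<inter> E" \<psi>] by blast
  qed
  then show ?thesis
    using assms unfolding smooth_atlas_def manifold_def by auto
qed

section \<open>Topology of a single chart\<close>

context
  fixes M :: "('a, 'e::euclidean_space) mfd" and D \<phi>
  assumes M: "smooth_atlas M" and chart: "(D, \<phi>) \<in> atlas M"
begin

lemma chart_openin: "openin (mtop M) D"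
  using M chart unfolding smooth_atlas_def by blast

lemma chart_homeomorphic_map: "homeomorphic_map (subtopology (mtop M) D) (top_of_set (\<phi> ` D)) \<phi>"
  using M chart unfolding smooth_atlas_def by blast

lemma chart_inj_on: "inj_on \<phi> D"
  using chart_openin chart_homeomorphic_map by (rule homeomorphic_map_chart_inj)

lemma chart_subset: "D \<subseteq> mcarrier M"
  using chart_openin openin_subset by blast

lemma chart_openin_preimage:
  assumes "open W"
  shows "openin (mtop M) {y\<in>D. \<phi> y \<in> W}"
proof -
  have "continuous_map (subtopology (mtop M) D) euclidean \<phi>"
    using homeomorphic_imp_continuous_map[OF chart_homeomorphic_map]
    by (simp add: continuous_map_in_subtopology)
  then have "openin (subtopology (mtop M) D) {y \<in> topspace (subtopology (mtop M) D). \<phi> y \<in> W}"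
    using assms by (auto simp: continuous_map_def)
  moreover have "topspace (subtopology (mtop M) D) = D" using chart_subset by auto
  ultimately show ?thesis using chart_openin openin_trans_full by metis
qed

text \<open>The chart image may lie in a proper subspace, so images of open sets are open only
  relative to it. What can be had in the model space is an open \<open>T\<close> that cuts out
  \<open>V\<close> on the chart domain.\<close>

lemma chart_openin_image:
  assumes "openin (mtop M) V"
  obtains T where "open T" "\<And>y. y \<in> D \<Longrightarrow> \<phi> y \<in> T \<longleftrightarrow> y \<in> V"
proof -
  have "openin (subtopology (mtop M) D) (V \<inter> D)"
    using assms by (simp add: openin_subtopology_Int)
  then have "openin (top_of_set (\<phi> ` D)) (\<phi> ` (V \<inter> D))"
    using homeomorphic_imp_open_map[OF chart_homeomorphic_map] by (simp add: open_map_def)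
  then obtain T where T: "open T" "\<phi> ` (V \<inter> D) = \<phi> ` D \<inter> T" by (auto simp: openin_open)
  have "\<phi> y \<in> T \<longleftrightarrow> y \<in> V" if "y \<in> D" for y
  proof -
    have "\<phi> y \<in> T \<longleftrightarrow> \<phi> y \<in> \<phi> ` (V \<inter> D)" using that T(2) by auto
    also have "\<dots> \<longleftrightarrow> y \<in> V \<inter> D" using chart_inj_on that by (auto simp: inj_on_def)
    finally show ?thesis using that by simp
  qed
  then show ?thesis using T(1) that by blast
qed

end

lemma chart_transition:
  assumes "smooth_atlas M" "(D, \<phi>) \<in> atlas M" "(E, \<psi>) \<in> atlas M" "x \<in> D" "x \<in> E"
  obtains W F where "cinf W F" "\<phi> x \<in> W" "\<And>y. y \<in> D \<Longrightarrow> y \<in> E \<Longrightarrow> \<phi> y \<in> W \<Longrightarrow> F (\<phi> y) = \<psi> y"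
proof -
  have "\<exists>W F. cinf W F \<and> \<phi> x \<in> W \<and> (\<forall>y\<in>D \<inter> E. \<phi> y \<in> W \<longrightarrow> F (\<phi> y) = \<psi> y)"
    using assms unfolding smooth_atlas_def by fast
  then show ?thesis using that by blast
qed

lemma chart_at:
  assumes "smooth_atlas M" "x \<in> mcarrier M"
  obtains D \<phi> where "(D, \<phi>) \<in> atlas M" "x \<in> D"
  using assms unfolding smooth_atlas_def by blast

text \<open>The germ form of \<open>smooth_map\<close>. One pair of charts suffices:
  \<open>smooth_at_in_charts\<close> passes to any other pair. Continuity is built in, because a
  whole neighborhood \<open>B\<close> goes into one target chart and \<open>F\<close> is continuous
  there.\<close>

definition smooth_at ::
  "('a, 'e::euclidean_space) mfd \<Rightarrow> ('b, 'f::euclidean_space) mfd \<Rightarrow> ('a \<Rightarrow> 'b) \<Rightarrow> 'a \<Rightarrow> bool" where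
  "smooth_at M N f x \<longleftrightarrow>
     (\<exists>D \<phi> E \<psi> B W F. (D, \<phi>) \<in> atlas M \<and> (E, \<psi>) \<in> atlas N \<and>
        openin (mtop M) B \<and> x \<in> B \<and> B \<subseteq> D \<and> f ` B \<subseteq> E \<and>
        cinf W F \<and> (\<forall>y\<in>B. \<phi> y \<in> W \<and> F (\<phi> y) = \<psi> (f y)))"

lemma smooth_atE:
  assumes "smooth_at M N f x"
  obtains D \<phi> E \<psi> B W F where "(D, \<phi>) \<in> atlas M" "(E, \<psi>) \<in> atlas N"
    "openin (mtop M) B" "x \<in> B" "B \<subseteq> D" "f ` B \<subseteq> E"
    "cinf W F" "\<And>y. y \<in> B \<Longrightarrow> \<phi> y \<in> W" "\<And>y. y \<in> B \<Longrightarrow> F (\<phi> y) = \<psi> (f y)"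
  using assms unfolding smooth_at_def by metis

lemma smooth_atI:
  assumes "(D, \<phi>) \<in> atlas M" "(E, \<psi>) \<in> atlas N"
    "openin (mtop M) B" "x \<in> B" "B \<subseteq> D" "f ` B \<subseteq> E"
    "cinf W F" "\<And>y. y \<in> B \<Longrightarrow> \<phi> y \<in> W" "\<And>y. y \<in> B \<Longrightarrow> F (\<phi> y) = \<psi> (f y)"
  shows "smooth_at M N f x"
  unfolding smooth_at_def using assms by blast

lemma smooth_at_continuous:
  assumes M: "smooth_atlas M" and N: "smooth_atlas N" and f: "smooth_at M N f x"
    and V: "openin (mtop N) V" "f x \<in> V"
  obtains B where "openin (mtop M) B" "x \<in> B" "f ` B \<subseteq> V"
  using f
proof (rule smooth_atE)
  fix D \<phi> E \<psi> B W F
  assume *: "(D, \<phi>) \<in> atlas M" "(E, \<psi>) \<in> atlas N"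
    "openin (mtop M) B" "x \<in> B" "B \<subseteq> D" "f ` B \<subseteq> E"
    "cinf W F" "\<And>y. y \<in> B \<Longrightarrow> \<phi> y \<in> W" "\<And>y. y \<in> B \<Longrightarrow> F (\<phi> y) = \<psi> (f y)"
  obtain T where T: "open T" "\<And>y. y \<in> E \<Longrightarrow> \<psi> y \<in> T \<longleftrightarrow> y \<in> V"
    using chart_openin_image[OF N *(2) V(1)] by blast
  have "open W" "continuous_on W F" using *(7) by (auto simp: cinf_def intro: Ck_on_continuous)
  then have "open (W \<inter> F -` T)" using T(1) by (simp add: continuous_open_preimage)
  then have "openin (mtop M) ({y\<in>D. \<phi> y \<in> W \<inter> F -` T} \<inter> B)"
    using chart_openin_preimage[OF M *(1)] *(3) by blast
  moreover have "x \<in> {y\<in>D. \<phi> y \<in> W \<inter> F -` T} \<inter> B"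
    using *(4,5,6,8) *(9)[of x] T(2)[of "f x"] V(2) by auto
  moreover have "f ` ({y\<in>D. \<phi> y \<in> W \<inter> F -` T} \<inter> B) \<subseteq> V"
    using *(6,9) T(2) by auto
  ultimately show ?thesis using that by blast
qed

lemma smooth_at_in_charts:
  assumes M: "smooth_atlas M" and N: "smooth_atlas N" and f: "smooth_at M N f x"
    and c: "(D, \<phi>) \<in> atlas M" "x \<in> D" "(E, \<psi>) \<in> atlas N" "f x \<in> E"
  obtains B W F where "openin (mtop M) B" "x \<in> B" "B \<subseteq> D" "f ` B \<subseteq> E"
    "cinf W F" "\<And>y. y \<in> B \<Longrightarrow> \<phi> y \<in> W" "\<And>y. y \<in> B \<Longrightarrow> F (\<phi> y) = \<psi> (f y)"
  using f
proof (rule smooth_atE)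
  fix D0 \<phi>0 E0 \<psi>0 B W F
  assume *: "(D0, \<phi>0) \<in> atlas M" "(E0, \<psi>0) \<in> atlas N"
    "openin (mtop M) B" "x \<in> B" "B \<subseteq> D0" "f ` B \<subseteq> E0"
    "cinf W F" "\<And>y. y \<in> B \<Longrightarrow> \<phi>0 y \<in> W" "\<And>y. y \<in> B \<Longrightarrow> F (\<phi>0 y) = \<psi>0 (f y)"
  obtain W1 F1 where 1: "cinf W1 F1" "\<phi> x \<in> W1"
    "\<And>y. y \<in> D \<Longrightarrow> y \<in> D0 \<Longrightarrow> \<phi> y \<in> W1 \<Longrightarrow> F1 (\<phi> y) = \<phi>0 y"
    using chart_transition[OF M c(1) *(1) c(2)] *(4,5) by blast
  obtain W2 F2 where 2: "cinf W2 F2" "\<psi>0 (f x) \<in> W2"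
    "\<And>y. y \<in> E0 \<Longrightarrow> y \<in> E \<Longrightarrow> \<psi>0 y \<in> W2 \<Longrightarrow> F2 (\<psi>0 y) = \<psi> y"
    using chart_transition[OF N *(2) c(3) _ c(4)] *(4,6) by blast
  obtain BE where BE: "openin (mtop M) BE" "x \<in> BE" "f ` BE \<subseteq> E"
    using smooth_at_continuous[OF M N f chart_openin[OF N c(3)] c(4)] by blast
  \<comment> \<open>The points where three maps can be applied in turn: \<open>F1\<close> changes
    the source chart, \<open>F\<close> represents \<open>f\<close> in the charts of its germ,
    \<open>F2\<close> changes the target chart.\<close>
  define V where "V = W1 \<inter> F1 -` W \<inter> (\<lambda>p. F (F1 p)) -` W2"
  have V: "cinf V (\<lambda>p. F2 (F (F1 p)))"
    unfolding V_def by (rule cinf_compose[OF cinf_compose[OF 1(1) *(7)] 2(1)])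
  define B' where "B' = {y\<in>D. \<phi> y \<in> V} \<inter> (B \<inter> BE)"
  show ?thesis
  proof (rule that[OF _ _ _ _ V])
    show "openin (mtop M) B'"
      unfolding B'_def using V chart_openin_preimage[OF M c(1)] *(3) BE(1)
      by (auto simp: cinf_def)
    show "x \<in> B'"
      using 1(2) 1(3)[of x] 2(2) *(4,5) *(8,9)[of x] BE(2) c(2) by (auto simp: B'_def V_def)
    show "B' \<subseteq> D" "f ` B' \<subseteq> E" using BE(3) by (auto simp: B'_def)
    fix y assume y: "y \<in> B'"
    then show "\<phi> y \<in> V" by (simp add: B'_def)
    have "F1 (\<phi> y) = \<phi>0 y" using y *(5) by (intro 1(3)) (auto simp: B'_def V_def)
    moreover have "F (\<phi>0 y) = \<psi>0 (f y)" using y by (intro *(9)) (auto simp: B'_def)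
    moreover have "F2 (\<psi>0 (f y)) = \<psi> (f y)"
      using y calculation *(6) BE(3) by (intro 2(3)) (auto simp: B'_def V_def)
    ultimately show "F2 (F (F1 (\<phi> y))) = \<psi> (f y)" by simp
  qed
qed

lemma smooth_map_imp_smooth_at:
  assumes M: "smooth_atlas M" and N: "smooth_atlas N" and f: "smooth_map M N f" and x: "x \<in> mcarrier M"
  shows "smooth_at M N f x"
proof -
  have cont: "continuous_map (mtop M) (mtop N) f" using f by (simp add: smooth_map_def)
  obtain D \<phi> where D: "(D, \<phi>) \<in> atlas M" "x \<in> D" using chart_at[OF M x] .
  have "f x \<in> mcarrier N" using cont x by (auto simp: continuous_map_def)
  then obtain E \<psi> where E: "(E, \<psi>) \<in> atlas N" "f x \<in> E" using chart_at[OF N] by blast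
  have "smooth_on (\<phi> ` {x\<in>D. f x \<in> E}) ((\<psi> \<circ> f) \<circ> inv_into D \<phi>)"
    using f D(1) E(1) unfolding smooth_map_def by auto
  then have "\<forall>x\<in>{x\<in>D. f x \<in> E}. \<exists>W F. cinf W F \<and> \<phi> x \<in> W \<and>
      (\<forall>y\<in>{x\<in>D. f x \<in> E}. \<phi> y \<in> W \<longrightarrow> F (\<phi> y) = (\<psi> \<circ> f) y)"
    by (subst (asm) smooth_on_image_iff[OF chart_inj_on[OF M D(1)]]) auto
  then obtain W F where F: "cinf W F" "\<phi> x \<in> W"
    "\<forall>y\<in>{x\<in>D. f x \<in> E}. \<phi> y \<in> W \<longrightarrow> F (\<phi> y) = (\<psi> \<circ> f) y"
    using D(2) E(2) by blast
  have "openin (mtop M) {y\<in>mcarrier M. f y \<in> E}"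
    using cont chart_openin[OF N E(1)] by (simp add: continuous_map_def)
  then have "openin (mtop M) ({y\<in>mcarrier M. f y \<in> E} \<inter> {y\<in>D. \<phi> y \<in> W})"
    using F(1) chart_openin_preimage[OF M D(1)] by (auto simp: cinf_def)
  then show ?thesis
    by (rule smooth_atI[OF D(1) E(1) _ _ _ _ F(1)]) (use D E F x in auto)
qed

lemma smooth_at_openin_preimage:
  assumes "smooth_atlas M" "smooth_atlas N" "\<And>x. x \<in> A \<Longrightarrow> smooth_at M N f x"
    and "openin (mtop M) A" "openin (mtop N) V"
  shows "openin (mtop M) {x\<in>A. f x \<in> V}"
proof (subst openin_subopen, intro ballI)
  fix x assume x: "x \<in> {x\<in>A. f x \<in> V}"
  then obtain B where "openin (mtop M) B" "x \<in> B" "f ` B \<subseteq> V"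
    using smooth_at_continuous[OF assms(1,2,3) assms(5)] by blast
  then show "\<exists>T. openin (mtop M) T \<and> x \<in> T \<and> T \<subseteq> {x\<in>A. f x \<in> V}"
    using x assms(4) by (intro exI[of _ "A \<inter> B"]) auto
qed

lemma smooth_at_imp_in_carrier:
  assumes "smooth_atlas N" "smooth_at M N f x"
  shows "f x \<in> mcarrier N"
  using assms(2) by (rule smooth_atE) (use chart_subset[OF assms(1)] in blast)

lemma smooth_mapI:
  assumes M: "smooth_atlas M" and N: "smooth_atlas N"
    and f: "\<And>x. x \<in> mcarrier M \<Longrightarrow> smooth_at M N f x"
  shows "smooth_map M N f"
proof -
  have "continuous_map (mtop M) (mtop N) f"
    unfolding continuous_map_def
    using smooth_at_imp_in_carrier[OF N f] smooth_at_openin_preimage[OF M N f] by blast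
  moreover have "smooth_on (\<phi> ` {x\<in>D. f x \<in> E}) ((\<psi> \<circ> f) \<circ> inv_into D \<phi>)"
    if D: "(D, \<phi>) \<in> atlas M" and E: "(E, \<psi>) \<in> atlas N" for D \<phi> E \<psi>
  proof (subst smooth_on_image_iff[OF chart_inj_on[OF M D]], blast, intro ballI)
    fix x assume x: "x \<in> {x\<in>D. f x \<in> E}"
    then have "smooth_at M N f x" using f chart_subset[OF M D] by blast
    then obtain B W F where *: "openin (mtop M) B" "x \<in> B" "B \<subseteq> D" "f ` B \<subseteq> E"
      "cinf W F" "\<And>y. y \<in> B \<Longrightarrow> \<phi> y \<in> W" "\<And>y. y \<in> B \<Longrightarrow> F (\<phi> y) = \<psi> (f y)"
      using smooth_at_in_charts[OF M N _ D _ E] x by blast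
    \<comment> \<open>\<open>F\<close> represents \<open>f\<close> only on \<open>B\<close>, while
      the goal concerns every point of \<open>D\<close> sent into the domain of \<open>F\<close>.
      Intersecting that domain with \<open>T\<close> leaves just points of \<open>B\<close>.\<close>
    obtain T where T: "open T" "\<And>y. y \<in> D \<Longrightarrow> \<phi> y \<in> T \<longleftrightarrow> y \<in> B"
      using chart_openin_image[OF M D *(1)] by blast
    have "cinf (T \<inter> W) F" using *(5) T(1) Ck_on_subset[of _ W F "T \<inter> W"] by (auto simp: cinf_def)
    then show "\<exists>W F. cinf W F \<and> \<phi> x \<in> W \<and>
        (\<forall>y\<in>{x\<in>D. f x \<in> E}. \<phi> y \<in> W \<longrightarrow> F (\<phi> y) = (\<psi> \<circ> f) y)"
      using *(2,6,7) T(2) x by (intro exI[of _ "T \<inter> W"] exI[of _ F]) auto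
  qed
  ultimately show ?thesis unfolding smooth_map_def by (auto simp: comp_assoc)
qed

lemma smooth_at_cong:
  assumes "smooth_at M N f x" "openin (mtop M) A" "x \<in> A" "\<And>y. y \<in> A \<Longrightarrow> f y = g y"
  shows "smooth_at M N g x"
  using assms(1)
proof (rule smooth_atE)
  fix D \<phi> E \<psi> B W F
  assume *: "(D, \<phi>) \<in> atlas M" "(E, \<psi>) \<in> atlas N"
    "openin (mtop M) B" "x \<in> B" "B \<subseteq> D" "f ` B \<subseteq> E"
    "cinf W F" "\<And>y. y \<in> B \<Longrightarrow> \<phi> y \<in> W" "\<And>y. y \<in> B \<Longrightarrow> F (\<phi> y) = \<psi> (f y)"
  show ?thesis
    by (rule smooth_atI[OF *(1,2) openin_Int[OF *(3) assms(2)] _ _ _ *(7)])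
      (use * assms(3,4) in \<open>auto simp flip: assms(4)\<close>)
qed

lemma smooth_at_compose:
  assumes M: "smooth_atlas M" and N: "smooth_atlas N" and P: "smooth_atlas P"
    and f: "smooth_at M N f x" and g: "smooth_at N P g (f x)"
  shows "smooth_at M P (\<lambda>y. g (f y)) x"
  using g
proof (rule smooth_atE)
  fix E \<psi> C \<omega> B2 W2 F2
  assume 2: "(E, \<psi>) \<in> atlas N" "(C, \<omega>) \<in> atlas P"
    "openin (mtop N) B2" "f x \<in> B2" "B2 \<subseteq> E" "g ` B2 \<subseteq> C"
    "cinf W2 F2" "\<And>y. y \<in> B2 \<Longrightarrow> \<psi> y \<in> W2" "\<And>y. y \<in> B2 \<Longrightarrow> F2 (\<psi> y) = \<omega> (g y)"
  obtain D \<phi> where D: "(D, \<phi>) \<in> atlas M" "x \<in> D"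
    using f by (rule smooth_atE) blast
  obtain B W F where 1: "openin (mtop M) B" "x \<in> B" "B \<subseteq> D" "f ` B \<subseteq> E"
    "cinf W F" "\<And>y. y \<in> B \<Longrightarrow> \<phi> y \<in> W" "\<And>y. y \<in> B \<Longrightarrow> F (\<phi> y) = \<psi> (f y)"
    using smooth_at_in_charts[OF M N f D 2(1)] 2(4,5) by blast
  obtain B' where B': "openin (mtop M) B'" "x \<in> B'" "f ` B' \<subseteq> B2"
    using smooth_at_continuous[OF M N f 2(3,4)] by blast
  show ?thesis
    by (rule smooth_atI[OF D(1) 2(2) openin_Int[OF 1(1) B'(1)] _ _ _ cinf_compose[OF 1(5) 2(7)]])
      (use 1 2 B' in \<open>auto simp: image_subset_iff\<close>)
qed

lemma smooth_at_id:
  assumes "smooth_atlas M" "x \<in> mcarrier M"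
  shows "smooth_at M M (\<lambda>y. y) x"
proof -
  obtain D \<phi> where D: "(D, \<phi>) \<in> atlas M" "x \<in> D" using chart_at[OF assms] .
  show ?thesis
    by (rule smooth_atI[OF D(1) D(1) chart_openin[OF assms(1) D(1)] D(2), where W = UNIV])
      (auto intro: cinf_linear bounded_linear_ident)
qed

section \<open>Restriction to subsets of a manifold\<close>

lemma mtop_open_submfd [simp]: "mtop (open_submfd M W) = subtopology (mtop M) W"
  by (simp add: open_submfd_def)

lemma atlas_open_submfd:
  "(D', \<phi>) \<in> atlas (open_submfd M W) \<longleftrightarrow> (\<exists>D. D' = D \<inter> W \<and> (D, \<phi>) \<in> atlas M)"
  by (auto simp: open_submfd_def)

text \<open>Bubbles come as submanifolds of the part of the unfolding over the regular set; this
  makes them submanifolds of the unfolding itself.\<close>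

lemma open_submfd_open_submfd:
  fixes M :: "('a, 'e) mfd"
  shows "open_submfd (open_submfd M V) W = open_submfd M (V \<inter> W)"
proof -
  have *: "atlas (open_submfd N A) = (\<lambda>(D, \<phi>). (D \<inter> A, \<phi>)) ` atlas N" for N :: "('a, 'e) mfd" and A
    by (auto simp: open_submfd_def)
  have "atlas (open_submfd (open_submfd M V) W) = atlas (open_submfd M (V \<inter> W))"
    by (simp add: * image_image case_prod_unfold Int_assoc)
  then show ?thesis by (simp add: open_submfd_def subtopology_subtopology)
qed

lemma smooth_atlas_open_submfd:
  assumes M: "smooth_atlas M"
  shows "smooth_atlas (open_submfd M W)"
  unfolding smooth_atlas_def
proof (intro conjI ballI, safe)
  fix D' \<phi> assume "(D', \<phi>) \<in> atlas (open_submfd M W)"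
  then obtain D where D: "D' = D \<inter> W" "(D, \<phi>) \<in> atlas M" by (auto simp: atlas_open_submfd)
  show "openin (mtop (open_submfd M W)) D'"
    using chart_openin[OF M D(2)] D(1) by (simp add: openin_subtopology_Int)
  have "homeomorphic_map (subtopology (subtopology (mtop M) D) (D \<inter> W))
      (subtopology (top_of_set (\<phi> ` D)) (\<phi> ` (D \<inter> W))) \<phi>"
    using chart_subset[OF M D(2)] chart_inj_on[OF M D(2)]
    by (intro homeomorphic_map_subtopologies[OF chart_homeomorphic_map[OF M D(2)]])
      (auto simp: inj_on_def)
  then show "homeomorphic_map (subtopology (mtop (open_submfd M W)) D') (top_of_set (\<phi> ` D')) \<phi>"
    unfolding D(1) by (simp add: subtopology_subtopology Int_ac Int_absorb1 image_mono)
  fix E' \<psi> x assume "(E', \<psi>) \<in> atlas (open_submfd M W)" and x: "x \<in> D'" "x \<in> E'"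
  then obtain E where E: "E' = E \<inter> W" "(E, \<psi>) \<in> atlas M" by (auto simp: atlas_open_submfd)
  obtain V F where "cinf V F" "\<phi> x \<in> V" "\<And>y. y \<in> D \<Longrightarrow> y \<in> E \<Longrightarrow> \<phi> y \<in> V \<Longrightarrow> F (\<phi> y) = \<psi> y"
    using chart_transition[OF M D(2) E(2)] D(1) E(1) x by blast
  then show "\<exists>W F. cinf W F \<and> \<phi> x \<in> W \<and> (\<forall>y\<in>D' \<inter> E'. \<phi> y \<in> W \<longrightarrow> F (\<phi> y) = \<psi> y)"
    unfolding D(1) E(1) by blast
next
  fix x assume "x \<in> mcarrier (open_submfd M W)"
  then have x: "x \<in> mcarrier M" "x \<in> W" by auto
  obtain D \<phi> where "(D, \<phi>) \<in> atlas M" "x \<in> D" using chart_at[OF M x(1)] .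
  then show "\<exists>(D, \<phi>)\<in>atlas (open_submfd M W). x \<in> D"
    using x(2) by (intro bexI[of _ "(D \<inter> W, \<phi>)"]) (auto simp: atlas_open_submfd)
qed

lemma smooth_at_submfd_domainD:
  assumes "smooth_at (open_submfd M W) N f x" "openin (mtop M) W"
  shows "smooth_at M N f x"
  using assms(1)
proof (rule smooth_atE)
  fix D' \<phi> E \<psi> B V F
  assume *: "(D', \<phi>) \<in> atlas (open_submfd M W)" "(E, \<psi>) \<in> atlas N"
    "openin (mtop (open_submfd M W)) B" "x \<in> B" "B \<subseteq> D'" "f ` B \<subseteq> E"
    "cinf V F" "\<And>y. y \<in> B \<Longrightarrow> \<phi> y \<in> V" "\<And>y. y \<in> B \<Longrightarrow> F (\<phi> y) = \<psi> (f y)"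
  obtain D where D: "D' = D \<inter> W" "(D, \<phi>) \<in> atlas M" using *(1) by (auto simp: atlas_open_submfd)
  have "openin (mtop M) B" using *(3) assms(2) openin_trans_full by (simp, blast)
  then show ?thesis
    by (rule smooth_atI[OF D(2) *(2) _ _ _ _ *(7)]) (use * D in auto)
qed

text \<open>The neighborhood \<open>A\<close> carried into \<open>W\<close> ensures that the chart
  domain cut down to \<open>W\<close> still contains the values of \<open>f\<close> near
  \<open>x\<close>.\<close>

lemma smooth_at_submfd_codomain:
  assumes "smooth_at M N f x" "openin (mtop M) A" "x \<in> A" "f ` A \<subseteq> W"
  shows "smooth_at M (open_submfd N W) f x"
  using assms(1)
proof (rule smooth_atE)
  fix D \<phi> E \<psi> B V F
  assume *: "(D, \<phi>) \<in> atlas M" "(E, \<psi>) \<in> atlas N"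
    "openin (mtop M) B" "x \<in> B" "B \<subseteq> D" "f ` B \<subseteq> E"
    "cinf V F" "\<And>y. y \<in> B \<Longrightarrow> \<phi> y \<in> V" "\<And>y. y \<in> B \<Longrightarrow> F (\<phi> y) = \<psi> (f y)"
  have "(E \<inter> W, \<psi>) \<in> atlas (open_submfd N W)" using *(2) by (auto simp: atlas_open_submfd)
  then show ?thesis
    by (rule smooth_atI[OF *(1) _ openin_Int[OF *(3) assms(2)] _ _ _ *(7)]) (use * assms in auto)
qed

lemma smooth_at_submfd_codomainD:
  assumes "smooth_at M (open_submfd N W) f x"
  shows "smooth_at M N f x"
  using assms
proof (rule smooth_atE)
  fix D \<phi> E' \<psi> B V F
  assume *: "(D, \<phi>) \<in> atlas M" "(E', \<psi>) \<in> atlas (open_submfd N W)"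
    "openin (mtop M) B" "x \<in> B" "B \<subseteq> D" "f ` B \<subseteq> E'"
    "cinf V F" "\<And>y. y \<in> B \<Longrightarrow> \<phi> y \<in> V" "\<And>y. y \<in> B \<Longrightarrow> F (\<phi> y) = \<psi> (f y)"
  obtain E where E: "E' = E \<inter> W" "(E, \<psi>) \<in> atlas N" using *(2) by (auto simp: atlas_open_submfd)
  show ?thesis by (rule smooth_atI[OF *(1) E(2) *(3,4,5) _ *(7,8,9)]) (use *(6) E(1) in auto)
qed

section \<open>Products and the real line\<close>

lemma mtop_prod_mfd [simp]: "mtop (prod_mfd M N) = prod_topology (mtop M) (mtop N)"
  by (simp add: prod_mfd_def)

lemma atlas_prod_mfd:
  "(C, \<omega>) \<in> atlas (prod_mfd M N) \<longleftrightarrow>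
    (\<exists>D \<phi> E \<psi>. C = D \<times> E \<and> \<omega> = map_prod \<phi> \<psi> \<and> (D, \<phi>) \<in> atlas M \<and> (E, \<psi>) \<in> atlas N)"
  by (auto simp: prod_mfd_def)

lemma smooth_atlas_prod_mfd:
  assumes M: "smooth_atlas M" and N: "smooth_atlas N"
  shows "smooth_atlas (prod_mfd M N)"
  unfolding smooth_atlas_def
proof (intro conjI ballI, safe)
  fix C \<omega> assume "(C, \<omega>) \<in> atlas (prod_mfd M N)"
  then obtain D \<phi> E \<psi> where C: "C = D \<times> E" "\<omega> = map_prod \<phi> \<psi>"
    "(D, \<phi>) \<in> atlas M" "(E, \<psi>) \<in> atlas N" by (auto simp: atlas_prod_mfd)
  show "openin (mtop (prod_mfd M N)) C"
    using chart_openin[OF M C(3)] chart_openin[OF N C(4)] by (simp add: C(1) openin_prod_Times_iff)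
  have "homeomorphic_map (prod_topology (subtopology (mtop M) D) (subtopology (mtop N) E))
     (prod_topology (top_of_set (\<phi> ` D)) (top_of_set (\<psi> ` E))) (\<lambda>(x, y). (\<phi> x, \<psi> y))"
    using chart_homeomorphic_map[OF M C(3)] chart_homeomorphic_map[OF N C(4)]
      homeomorphic_maps_prod[of "subtopology (mtop M) D" "subtopology (mtop N) E"
        "top_of_set (\<phi> ` D)" "top_of_set (\<psi> ` E)" \<phi> \<psi>]
    unfolding homeomorphic_map_maps by blast
  moreover have "prod_topology (top_of_set (\<phi> ` D)) (top_of_set (\<psi> ` E)) = top_of_set (\<omega> ` C)"
    by (simp add: C(1,2) map_prod_image)
  ultimately show "homeomorphic_map (subtopology (mtop (prod_mfd M N)) C) (top_of_set (\<omega> ` C)) \<omega>"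
    by (simp add: C(1,2) subtopology_Times map_prod_def)
  fix C' \<omega>' x y assume "(C', \<omega>') \<in> atlas (prod_mfd M N)" and x: "(x, y) \<in> C" "(x, y) \<in> C'"
  then obtain D' \<phi>' E' \<psi>' where C': "C' = D' \<times> E'" "\<omega>' = map_prod \<phi>' \<psi>'"
    "(D', \<phi>') \<in> atlas M" "(E', \<psi>') \<in> atlas N" by (auto simp: atlas_prod_mfd)
  obtain W F where 1: "cinf W F" "\<phi> x \<in> W"
    "\<And>y. y \<in> D \<Longrightarrow> y \<in> D' \<Longrightarrow> \<phi> y \<in> W \<Longrightarrow> F (\<phi> y) = \<phi>' y"
    using chart_transition[OF M C(3) C'(3)] x C(1) C'(1) by (metis mem_Sigma_iff)
  obtain V G where 2: "cinf V G" "\<psi> y \<in> V"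
    "\<And>y. y \<in> E \<Longrightarrow> y \<in> E' \<Longrightarrow> \<psi> y \<in> V \<Longrightarrow> G (\<psi> y) = \<psi>' y"
    using chart_transition[OF N C(4) C'(4)] x C(1) C'(1) by (metis mem_Sigma_iff)
  show "\<exists>W F. cinf W F \<and> \<omega> (x, y) \<in> W \<and> (\<forall>y\<in>C \<inter> C'. \<omega> y \<in> W \<longrightarrow> F (\<omega> y) = \<omega>' y)"
    using 1(2,3) 2(2,3) unfolding C C'
    by (intro exI[of _ "W \<times> V"] exI[of _ "map_prod F G"] conjI cinf_map_prod[OF 1(1) 2(1)]) auto
next
  fix x y assume "(x, y) \<in> mcarrier (prod_mfd M N)"
  then have "x \<in> mcarrier M" "y \<in> mcarrier N" by auto
  then obtain D \<phi> E \<psi> where "(D, \<phi>) \<in> atlas M" "x \<in> D" "(E, \<psi>) \<in> atlas N" "y \<in> E"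
    using chart_at[OF M] chart_at[OF N] by metis
  then show "\<exists>(C, \<omega>)\<in>atlas (prod_mfd M N). (x, y) \<in> C"
    by (intro bexI[of _ "(D \<times> E, map_prod \<phi> \<psi>)"]) (auto simp: atlas_prod_mfd)
qed

lemma smooth_at_fst_snd:
  assumes M: "smooth_atlas M" and N: "smooth_atlas N" and p: "p \<in> mcarrier M \<times> mcarrier N"
  shows smooth_at_fst: "smooth_at (prod_mfd M N) M fst p"
    and smooth_at_snd: "smooth_at (prod_mfd M N) N snd p"
proof -
  obtain D \<phi> E \<psi> where D: "(D, \<phi>) \<in> atlas M" "fst p \<in> D" and E: "(E, \<psi>) \<in> atlas N" "snd p \<in> E"
    using chart_at[OF M, of "fst p"] chart_at[OF N, of "snd p"] p by (metis mem_Times_iff)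
  have C: "(D \<times> E, map_prod \<phi> \<psi>) \<in> atlas (prod_mfd M N)" using D E by (auto simp: atlas_prod_mfd)
  note o = chart_openin[OF smooth_atlas_prod_mfd[OF M N] C]
  show "smooth_at (prod_mfd M N) M fst p"
    by (rule smooth_atI[OF C D(1) o _ _ _ cinf_linear[OF bounded_linear_fst]])
      (use D E in \<open>auto simp: mem_Times_iff\<close>)
  show "smooth_at (prod_mfd M N) N snd p"
    by (rule smooth_atI[OF C E(1) o _ _ _ cinf_linear[OF bounded_linear_snd]])
      (use D E in \<open>auto simp: mem_Times_iff\<close>)
qed

lemma smooth_at_Pair:
  assumes P: "smooth_atlas P" and M: "smooth_atlas M" and N: "smooth_atlas N"
    and f: "smooth_at P M f x" and g: "smooth_at P N g x"
  shows "smooth_at P (prod_mfd M N) (\<lambda>y. (f y, g y)) x"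
  using f
proof (rule smooth_atE)
  fix D \<phi> E \<psi> B W F
  assume 1: "(D, \<phi>) \<in> atlas P" "(E, \<psi>) \<in> atlas M"
    "openin (mtop P) B" "x \<in> B" "B \<subseteq> D" "f ` B \<subseteq> E"
    "cinf W F" "\<And>y. y \<in> B \<Longrightarrow> \<phi> y \<in> W" "\<And>y. y \<in> B \<Longrightarrow> F (\<phi> y) = \<psi> (f y)"
  obtain E' \<psi>' where E': "(E', \<psi>') \<in> atlas N" "g x \<in> E'"
    using chart_at[OF N smooth_at_imp_in_carrier[OF N g]] .
  obtain B' V G where 2: "openin (mtop P) B'" "x \<in> B'" "B' \<subseteq> D" "g ` B' \<subseteq> E'"
    "cinf V G" "\<And>y. y \<in> B' \<Longrightarrow> \<phi> y \<in> V" "\<And>y. y \<in> B' \<Longrightarrow> G (\<phi> y) = \<psi>' (g y)"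
    using smooth_at_in_charts[OF P N g 1(1) _ E'] 1(4,5) by blast
  have C: "(E \<times> E', map_prod \<psi> \<psi>') \<in> atlas (prod_mfd M N)"
    using 1(2) E' by (auto simp: atlas_prod_mfd)
  show ?thesis
    by (rule smooth_atI[OF 1(1) C openin_Int[OF 1(3) 2(1)] _ _ _ cinf_Pair[OF 1(7) 2(5)]])
      (use 1 2 in auto)
qed

lemma smooth_atlas_real_mfd: "smooth_atlas real_mfd"
proof -
  have "\<exists>W F. cinf W F \<and> x \<in> W \<and> (\<forall>y. y \<in> W \<longrightarrow> F y = y)" for x :: real
    by (rule exI[of _ UNIV], rule exI[of _ "\<lambda>x. x"]) (simp add: cinf_linear bounded_linear_ident)
  then show ?thesis by (simp add: smooth_atlas_def real_mfd_def)
qed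

lemma smooth_at_real_mult: "smooth_at real_mfd real_mfd (\<lambda>t. c * t) x"
  by (rule smooth_atI[where D = UNIV and \<phi> = id and E = UNIV and \<psi> = id and B = UNIV and W = UNIV and F = "\<lambda>t. c * t"])
    (auto intro!: cinf_linear bounded_linear_mult_right simp: real_mfd_def)

section \<open>Cone charts\<close>

lemma singular_stratum_subset:
  "S \<in> singular_strata X \<Longrightarrow> S \<subseteq> mcarrier (singular X)"
  unfolding singular_strata_def by (rule connected_components_of_subset)

context
  fixes X :: "('a, 'r::euclidean_space, 's::euclidean_space) sspace"
    and Lk :: "'a set \<Rightarrow> ('l, 'k::euclidean_space) mfd" and S U \<alpha>
  assumes X: "simple_space X" and S: "S \<in> singular_strata X" and chart: "cone_chart X Lk S U \<alpha>"
begin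

lemma cone_chart_subset_stratum: "U \<subseteq> S"
  using chart openin_subset unfolding cone_chart_def by fastforce

lemma cone_chart_subset_singular: "U \<subseteq> mcarrier (singular X)"
  using cone_chart_subset_stratum singular_stratum_subset[OF S] by blast

lemma cone_chart_image:
  "\<alpha> ` topspace (space_top (cone_bundle (open_submfd (singular X) U) (Lk S))) = chart_image (Lk S) U \<alpha>"
  using cone_chart_subset_singular
  by (simp add: chart_image_def cone_bundle_def Int_absorb1)

lemma openin_chart_image: "openin (space_top X) (chart_image (Lk S) U \<alpha>)"
  using chart unfolding cone_chart_def open_embedding_def cone_chart_image by blast

lemma cone_chart_vertex: "u \<in> U \<Longrightarrow> \<alpha> (u, cone_pt (Lk S) l 0) = u"
  using chart by (simp add: cone_chart_def cone_pt_def)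

text \<open>The vertex lies in the domain of \<open>\<alpha>\<close> even though \<open>cone_top L\<close> is empty for empty \<open>L\<close>: an
  embedding with empty link could not be an isomorphism of singular parts.\<close>

lemma cone_chart_subset_image: "U \<subseteq> chart_image (Lk S) U \<alpha>"
proof
  fix u assume u: "u \<in> U"
  let ?C = "cone_bundle (open_submfd (singular X) U) (Lk S)"
  have "simple_iso ?C (open_subsspace X (chart_image (Lk S) U \<alpha>)) \<alpha>"
    using chart unfolding cone_chart_def open_embedding_def cone_chart_image by blast
  then have "continuous_map (mtop (singular ?C))
      (subtopology (mtop (singular X)) (chart_image (Lk S) U \<alpha>)) \<alpha>"
    by (simp add: simple_iso_def diffeomorphism_def smooth_map_def open_subsspace_def)
  moreover have "(u, cone_vertex (Lk S)) \<in> topspace (mtop (singular ?C))"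
    using u cone_chart_subset_singular
    by (auto simp: cone_bundle_def transport_mfd_def topspace_quotient_topology)
  ultimately have "\<alpha> (u, cone_vertex (Lk S)) \<in> chart_image (Lk S) U \<alpha>"
    by (auto simp: continuous_map_def)
  then show "u \<in> chart_image (Lk S) U \<alpha>"
    using chart u by (simp add: cone_chart_def)
qed

lemma cone_chart_regular:
  assumes "u \<in> U" "l \<in> mcarrier (Lk S)" "0 < r"
  shows "\<alpha> (u, cone_pt (Lk S) l r) \<in> mcarrier (regular X)"
proof -
  let ?C = "cone_bundle (open_submfd (singular X) U) (Lk S)"
  have "(u, cone_pt (Lk S) l r) \<in> mcarrier (regular ?C)"
    using assms cone_chart_subset_singular
    by (auto simp: cone_bundle_def transport_mfd_def topspace_quotient_topology real_mfd_def
        intro!: image_eqI[of _ _ "(u, l, r)"])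
  moreover have "simple_morphism ?C X \<alpha>"
    using chart by (simp add: cone_chart_def open_embedding_def)
  ultimately show ?thesis unfolding simple_morphism_def by blast
qed

end

section \<open>Sheets and folded charts of a primary unfolding\<close>

text \<open>Bubbles are indexed by \<open>bool\<close>; \<open>R True\<close> and \<open>R False\<close> are both empty if the regular part is.\<close>

definition sheets ::
  "('a, 'r::euclidean_space, 's::euclidean_space) sspace \<Rightarrow> ('b, 'e::euclidean_space) mfd \<Rightarrow>
   ('b \<Rightarrow> 'a) \<Rightarrow> (bool \<Rightarrow> 'b set) \<Rightarrow> bool" where
  "sheets X Xt \<L> R \<longleftrightarrow>
     R True \<inter> R False = {} \<and> R True \<union> R False = preim Xt \<L> (mcarrier (regular X)) \<and>
     (\<forall>j. openin (mtop Xt) (R j) \<and>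
       (\<exists>g. (\<forall>x\<in>mcarrier (regular X). g x \<in> R j \<and> \<L> (g x) = x \<and> smooth_at (regular X) Xt g x) \<and>
            (\<forall>z\<in>R j. smooth_at Xt (regular X) \<L> z \<and> g (\<L> z) = z)))"

lemma sheets_eq: "sheets X Xt \<L> R \<Longrightarrow> z \<in> R i \<Longrightarrow> z \<in> R j \<Longrightarrow> i = j"
  unfolding sheets_def by (cases i; cases j) auto

lemma sheets_ex_iff: "sheets X Xt \<L> R \<Longrightarrow> (\<exists>j. z \<in> R j) \<longleftrightarrow> z \<in> mcarrier Xt \<and> \<L> z \<in> mcarrier (regular X)"
  unfolding sheets_def preim_def ex_bool_eq by blast

lemma sheets_openin: "sheets X Xt \<L> R \<Longrightarrow> openin (mtop Xt) (R j)"
  unfolding sheets_def by blast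

lemma sheets_section:
  assumes "sheets X Xt \<L> R"
  obtains g where
    "\<And>x. x \<in> mcarrier (regular X) \<Longrightarrow> g x \<in> R j \<and> \<L> (g x) = x \<and> smooth_at (regular X) Xt g x"
    "\<And>z. z \<in> R j \<Longrightarrow> smooth_at Xt (regular X) \<L> z \<and> g (\<L> z) = z"
  using assms unfolding sheets_def by meson

lemma sheets_inj:
  assumes "sheets X Xt \<L> R" "z \<in> R j" "z' \<in> R j" "\<L> z = \<L> z'"
  shows "z = z'"
  using sheets_section[OF assms(1), of j] assms(2-4) by metis

text \<open>The diffeomorphism of the unfolding axiom with its inverse \<open>b\<close> carried as
  data. Both are smooth as germs with respect to \<open>Xt\<close>, so that the submanifold over the
  chart image drops out of later arguments.\<close>

definition fold_chart ::
  "('a, 'r::euclidean_space, 's::euclidean_space) sspace \<Rightarrow> ('l, 'k::euclidean_space) mfd \<Rightarrow> 'a set \<Rightarrow>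
   ('a \<times> ('l \<times> real) set \<Rightarrow> 'a) \<Rightarrow> ('b, 'e::euclidean_space) mfd \<Rightarrow> ('b \<Rightarrow> 'a) \<Rightarrow>
   ('a \<times> 'l \<times> real \<Rightarrow> 'b) \<Rightarrow> ('b \<Rightarrow> 'a \<times> 'l \<times> real) \<Rightarrow> bool" where
  "fold_chart X \<Lambda> U \<alpha> Xt \<L> a b \<longleftrightarrow>
     (let P = prod_mfd (open_submfd (singular X) U) (prod_mfd \<Lambda> real_mfd);
          C = preim Xt \<L> (chart_image \<Lambda> U \<alpha>)
      in (\<forall>u\<in>U. \<forall>l\<in>mcarrier \<Lambda>. \<forall>t. a (u, l, t) \<in> C \<and> b (a (u, l, t)) = (u, l, t) \<and>
            smooth_at P Xt a (u, l, t) \<and> \<L> (a (u, l, t)) = \<alpha> (u, cone_pt \<Lambda> l \<bar>t\<bar>)) \<and>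
         (\<forall>z\<in>C. b z \<in> U \<times> mcarrier \<Lambda> \<times> UNIV \<and> a (b z) = z \<and> smooth_at Xt P b z))"

lemma fold_chartD:
  assumes "fold_chart X \<Lambda> U \<alpha> Xt \<L> a b" "u \<in> U" "l \<in> mcarrier \<Lambda>"
  shows "a (u, l, t) \<in> preim Xt \<L> (chart_image \<Lambda> U \<alpha>)" "b (a (u, l, t)) = (u, l, t)"
    "smooth_at (prod_mfd (open_submfd (singular X) U) (prod_mfd \<Lambda> real_mfd)) Xt a (u, l, t)"
    "\<L> (a (u, l, t)) = \<alpha> (u, cone_pt \<Lambda> l \<bar>t\<bar>)"
  using assms unfolding fold_chart_def Let_def by blast+

lemma fold_chart_inverseD:
  assumes "fold_chart X \<Lambda> U \<alpha> Xt \<L> a b" "z \<in> preim Xt \<L> (chart_image \<Lambda> U \<alpha>)"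
  shows "b z \<in> U \<times> mcarrier \<Lambda> \<times> UNIV" "a (b z) = z"
    "smooth_at Xt (prod_mfd (open_submfd (singular X) U) (prod_mfd \<Lambda> real_mfd)) b z"
  using assms unfolding fold_chart_def Let_def by blast+

lemma mcarrier_real_mfd [simp]: "mcarrier real_mfd = UNIV" and mtop_real_mfd [simp]: "mtop real_mfd = euclideanreal"
  by (simp_all add: real_mfd_def)

section \<open>From the unfolding axioms to sheets and folded charts\<close>

lemma diffeomorphism_inverse:
  assumes M: "smooth_atlas M" and N: "smooth_atlas N" and f: "diffeomorphism M N f"
  obtains g where
    "\<And>x. x \<in> mcarrier M \<Longrightarrow> f x \<in> mcarrier N \<and> g (f x) = x \<and> smooth_at M N f x"
    "\<And>y. y \<in> mcarrier N \<Longrightarrow> g y \<in> mcarrier M \<and> f (g y) = y \<and> smooth_at N M g y"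
proof -
  obtain g where g: "smooth_map M N f" "smooth_map N M g"
    "\<forall>x\<in>mcarrier M. g (f x) = x" "\<forall>y\<in>mcarrier N. f (g y) = y"
    using f unfolding diffeomorphism_def by blast
  have "f x \<in> mcarrier N" if "x \<in> mcarrier M" for x
    using g(1) that by (auto simp: smooth_map_def continuous_map_def)
  moreover have "g y \<in> mcarrier M" if "y \<in> mcarrier N" for y
    using g(2) that by (auto simp: smooth_map_def continuous_map_def)
  ultimately show ?thesis
    using that g smooth_map_imp_smooth_at[OF M N g(1)] smooth_map_imp_smooth_at[OF N M g(2)] by blast
qed

lemma openin_preim:
  "continuous_map (mtop Xt) Y \<L> \<Longrightarrow> openin Y A \<Longrightarrow> openin (mtop Xt) (preim Xt \<L> A)"
  unfolding preim_def by (simp add: continuous_map_def)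

lemma primary_unfolding_sheets:
  assumes X: "simple_space X" and Xt: "primary_unfolding X Lk Tb Xt \<L>"
  obtains R where "sheets X Xt \<L> R"
proof -
  let ?P = "preim Xt \<L> (mcarrier (regular X))"
  obtain R0 R1 where R: "disjnt R0 R1"
    "smooth_trivial_covering (open_submfd Xt ?P) (regular X) \<L> {R0, R1}"
    using Xt unfolding primary_unfolding_def by blast
  have M: "smooth_atlas Xt" and cont: "continuous_map (mtop Xt) (space_top X) \<L>"
    using Xt
    by (auto simp: primary_unfolding_def thom_mather_unfolding_def unfolding_with_def
        intro: manifold_imp_smooth_atlas)
  have N: "smooth_atlas (regular X)" and o: "openin (space_top X) (mcarrier (regular X))"
    using X by (auto simp: simple_space_def intro: manifold_imp_smooth_atlas)
  have P: "openin (mtop Xt) ?P" using openin_preim[OF cont o] .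
  have sheet: "openin (mtop Xt) W \<and>
      (\<exists>g. (\<forall>x\<in>mcarrier (regular X). g x \<in> W \<and> \<L> (g x) = x \<and> smooth_at (regular X) Xt g x) \<and>
           (\<forall>z\<in>W. smooth_at Xt (regular X) \<L> z \<and> g (\<L> z) = z))" if "W \<in> {R0, R1}" for W
  proof -
    have W: "openin (subtopology (mtop Xt) ?P) W"
      "diffeomorphism (open_submfd (open_submfd Xt ?P) W) (regular X) \<L>"
      using R(2) that by (auto simp: smooth_trivial_covering_def)
    then have WP: "W \<subseteq> ?P" using openin_subset by fastforce
    have oW: "openin (mtop Xt) W" using W(1) P openin_trans_full by blast
    have W': "mcarrier (open_submfd Xt W) = W" using openin_subset[OF oW] by auto
    have "diffeomorphism (open_submfd Xt W) (regular X) \<L>"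
      using W(2) WP by (simp add: open_submfd_open_submfd Int_absorb1)
    then obtain g where g:
      "\<And>x. x \<in> W \<Longrightarrow> \<L> x \<in> mcarrier (regular X) \<and> g (\<L> x) = x \<and> smooth_at (open_submfd Xt W) (regular X) \<L> x"
      "\<And>y. y \<in> mcarrier (regular X) \<Longrightarrow> g y \<in> W \<and> \<L> (g y) = y \<and> smooth_at (regular X) (open_submfd Xt W) g y"
      using diffeomorphism_inverse[OF smooth_atlas_open_submfd[OF M] N] W' by metis
    have "(\<forall>x\<in>mcarrier (regular X). g x \<in> W \<and> \<L> (g x) = x \<and> smooth_at (regular X) Xt g x) \<and>
           (\<forall>z\<in>W. smooth_at Xt (regular X) \<L> z \<and> g (\<L> z) = z)"
      using g oW by (auto intro: smooth_at_submfd_domainD smooth_at_submfd_codomainD)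
    then show ?thesis using oW by blast
  qed
  have "mcarrier (open_submfd Xt ?P) = ?P" by (auto simp: preim_def)
  then have "R0 \<union> R1 = ?P" using R(2) by (simp add: smooth_trivial_covering_def)
  \<comment> \<open>The labelling is an arbitrary choice. The opposite choice for one of two
    unfoldings leads to the lift that exchanges the bubbles.\<close>
  then have "sheets X Xt \<L> (\<lambda>j. if j then R0 else R1)"
    unfolding sheets_def using R(1) sheet by (simp add: disjnt_def all_bool_eq)
  then show ?thesis using that by blast
qed

text \<open>Chart images are open in \<open>X\<close>, so their preimages are open in
  \<open>Xt\<close>, and germs in the submanifold over a chart image are germs in
  \<open>Xt\<close>.\<close>

lemma unfolding_fold_chart:
  assumes X: "simple_pseudomanifold X Lk" and Xt: "unfolding_with X Lk Ch Xt \<L>"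
    and z: "z \<in> mcarrier Xt" "\<L> z \<in> mcarrier (singular X)"
  obtains S U \<alpha> a b where "S \<in> singular_strata X" "(U, \<alpha>) \<in> Ch S" "cone_chart X Lk S U \<alpha>" "\<L> z \<in> U"
    "fold_chart X (Lk S) U \<alpha> Xt \<L> a b"
proof -
  have "z \<in> preim Xt \<L> (mcarrier (singular X))" using z by (simp add: preim_def)
  then have "\<exists>S\<in>singular_strata X. \<exists>(U, \<alpha>)\<in>Ch S. \<exists>\<alpha>t.
          \<L> z \<in> U \<and> cone_chart X Lk S U \<alpha> \<and>
          diffeomorphism
            (prod_mfd (open_submfd (singular X) U) (prod_mfd (Lk S) real_mfd))
            (open_submfd Xt (preim Xt \<L> (chart_image (Lk S) U \<alpha>))) \<alpha>t \<and>
          (\<forall>u\<in>U. \<forall>l\<in>mcarrier (Lk S). \<forall>t.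
             \<L> (\<alpha>t (u, l, t)) = \<alpha> (u, cone_pt (Lk S) l \<bar>t\<bar>))"
    using Xt unfolding unfolding_with_def by blast
  then obtain S U \<alpha> a where *: "S \<in> singular_strata X" "(U, \<alpha>) \<in> Ch S" "\<L> z \<in> U"
    "cone_chart X Lk S U \<alpha>"
    "diffeomorphism (prod_mfd (open_submfd (singular X) U) (prod_mfd (Lk S) real_mfd))
       (open_submfd Xt (preim Xt \<L> (chart_image (Lk S) U \<alpha>))) a"
    "\<forall>u\<in>U. \<forall>l\<in>mcarrier (Lk S). \<forall>t. \<L> (a (u, l, t)) = \<alpha> (u, cone_pt (Lk S) l \<bar>t\<bar>)"
    by blast
  let ?P = "prod_mfd (open_submfd (singular X) U) (prod_mfd (Lk S) real_mfd)"
  let ?C = "preim Xt \<L> (chart_image (Lk S) U \<alpha>)"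
  have sX: "simple_space X" and L: "smooth_atlas (Lk S)"
    using X *(1) by (auto simp: simple_pseudomanifold_def intro: manifold_imp_smooth_atlas)
  have sing: "smooth_atlas (singular X)"
    using sX by (auto simp: simple_space_def intro: manifold_imp_smooth_atlas)
  have P: "smooth_atlas ?P"
    by (intro smooth_atlas_prod_mfd smooth_atlas_open_submfd smooth_atlas_real_mfd sing L)
  have M: "smooth_atlas Xt" and cont: "continuous_map (mtop Xt) (space_top X) \<L>"
    using Xt by (auto simp: unfolding_with_def intro: manifold_imp_smooth_atlas)
  have C: "openin (mtop Xt) ?C"
    using openin_preim[OF cont openin_chart_image[OF sX *(1,4)]] .
  have U: "U \<subseteq> mcarrier (singular X)" using cone_chart_subset_singular[OF sX *(1,4)] .
  have mP: "mcarrier ?P = U \<times> mcarrier (Lk S) \<times> UNIV" using U by auto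
  have mC: "mcarrier (open_submfd Xt ?C) = ?C" using openin_subset[OF C] by auto
  obtain b where b:
    "\<And>x. x \<in> U \<times> mcarrier (Lk S) \<times> UNIV \<Longrightarrow> a x \<in> ?C \<and> b (a x) = x \<and> smooth_at ?P (open_submfd Xt ?C) a x"
    "\<And>y. y \<in> ?C \<Longrightarrow> b y \<in> U \<times> mcarrier (Lk S) \<times> UNIV \<and> a (b y) = y \<and> smooth_at (open_submfd Xt ?C) ?P b y"
    using diffeomorphism_inverse[OF P smooth_atlas_open_submfd[OF M] *(5)] unfolding mP mC by metis
  have "fold_chart X (Lk S) U \<alpha> Xt \<L> a b"
    unfolding fold_chart_def Let_def
  proof (intro conjI ballI allI)
    fix u l t assume ul: "u \<in> U" "l \<in> mcarrier (Lk S)"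
    then have p: "(u, l, t) \<in> U \<times> mcarrier (Lk S) \<times> (UNIV :: real set)" by blast
    show "a (u, l, t) \<in> ?C" "b (a (u, l, t)) = (u, l, t)" using b(1)[OF p] by auto
    show "smooth_at ?P Xt a (u, l, t)" by (rule smooth_at_submfd_codomainD) (use b(1)[OF p] in blast)
    show "\<L> (a (u, l, t)) = \<alpha> (u, cone_pt (Lk S) l \<bar>t\<bar>)" using *(6) ul by blast
  next
    fix y assume y: "y \<in> ?C"
    show "b y \<in> U \<times> mcarrier (Lk S) \<times> UNIV" "a (b y) = y" using b(2)[OF y] by auto
    show "smooth_at Xt ?P b y" by (rule smooth_at_submfd_domainD[OF _ C]) (use b(2)[OF y] in blast)
  qed
  then show ?thesis using that * by blast
qed

lemma fold_chart_openin_preimage: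
  assumes a: "fold_chart X \<Lambda> U \<alpha> Xt \<L> a b"
    and M: "smooth_atlas Xt" "smooth_atlas \<Lambda>" "smooth_atlas (singular X)" and U: "U \<subseteq> mcarrier (singular X)"
    and V: "openin (mtop Xt) V"
  shows "openin (prod_topology (subtopology (mtop (singular X)) U) (prod_topology (mtop \<Lambda>) euclideanreal))
    {p \<in> U \<times> mcarrier \<Lambda> \<times> UNIV. a p \<in> V}"
proof -
  let ?P = "prod_mfd (open_submfd (singular X) U) (prod_mfd \<Lambda> real_mfd)"
  have P: "smooth_atlas ?P"
    by (intro smooth_atlas_prod_mfd smooth_atlas_open_submfd smooth_atlas_real_mfd M)
  have mP: "mcarrier ?P = U \<times> mcarrier \<Lambda> \<times> UNIV" using U by auto
  have "openin (mtop ?P) {p \<in> U \<times> mcarrier \<Lambda> \<times> UNIV. a p \<in> V}"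
  proof (rule smooth_at_openin_preimage[OF P M(1) _ _ V])
    show "openin (mtop ?P) (U \<times> mcarrier \<Lambda> \<times> UNIV)" by (metis mP openin_topspace)
  qed (use fold_chartD(3)[OF a] in auto)
  then show ?thesis by simp
qed

text \<open>Connectedness of the link forces each half of a fibre of the folded chart into one sheet; the
  two halves have the same image in \<open>X\<close>, so they lie in different sheets. The labelling \<open>s\<close> is
  locally constant because the sheets are open.\<close>

lemma fold_chart_sheet:
  assumes a: "fold_chart X \<Lambda> U \<alpha> Xt \<L> a b" and R: "sheets X Xt \<L> R"
    and M: "smooth_atlas Xt" "smooth_atlas \<Lambda>" "smooth_atlas (singular X)" and U: "U \<subseteq> mcarrier (singular X)"
    and conn: "connected_space (mtop \<Lambda>)"
    and reg: "\<And>u l r. u \<in> U \<Longrightarrow> l \<in> mcarrier \<Lambda> \<Longrightarrow> 0 < r \<Longrightarrow> \<alpha> (u, cone_pt \<Lambda> l r) \<in> mcarrier (regular X)"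
    and u0: "u0 \<in> U" and l0: "l0 \<in> mcarrier \<Lambda>"
  obtains A s where "openin (subtopology (mtop (singular X)) U) A" "u0 \<in> A"
    "\<And>u l t. u \<in> A \<Longrightarrow> l \<in> mcarrier \<Lambda> \<Longrightarrow> t \<noteq> 0 \<Longrightarrow> a (u, l, t) \<in> R ((0 < t) = s)"
proof -
  let ?T = "prod_topology (subtopology (mtop (singular X)) U) (prod_topology (mtop \<Lambda>) euclideanreal)"
  have sheet: "\<exists>j. a (u, l, t) \<in> R j" if "u \<in> U" "l \<in> mcarrier \<Lambda>" "t \<noteq> 0" for u l t
    unfolding sheets_ex_iff[OF R]
    using fold_chartD(1,4)[OF a that(1,2), of t] reg[OF that(1,2), of "\<bar>t\<bar>"] that(3)
    by (simp add: preim_def)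
  obtain s where s: "a (u0, l0, 1) \<in> R s" using sheet[OF u0 l0, of 1] by auto
  define G where "G j = {p \<in> U \<times> mcarrier \<Lambda> \<times> UNIV. a p \<in> R j}" for j
  have G: "openin ?T (G j)" for j
    unfolding G_def by (rule fold_chart_openin_preimage[OF a M U sheets_openin[OF R]])
  have mU: "topspace (subtopology (mtop (singular X)) U) = U" using U by auto
  \<comment> \<open>The label is tested at the single point with link coordinate \<open>l0\<close>
    and parameter 1. Connectedness of the positive half of the fibre then spreads it to all
    \<open>l\<close> and all \<open>t > 0\<close>, so openness of one sheet near one point is
    enough.\<close>
  define A where "A = {u \<in> topspace (subtopology (mtop (singular X)) U). (u, l0, 1) \<in> G s}"
  have A: "openin (subtopology (mtop (singular X)) U) A"
    unfolding A_def
    by (rule openin_continuous_map_preimage[OF _ G])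
      (use l0 in \<open>auto simp: continuous_map_paired continuous_map_const intro: continuous_map_id[unfolded id_def]\<close>)
  have pos: "a (u, l, t) \<in> R s" if u: "u \<in> A" and l: "l \<in> mcarrier \<Lambda>" and t: "0 < t" for u l t
  proof -
    let ?Y = "prod_topology (mtop \<Lambda>) (top_of_set {0::real<..})"
    let ?E = "\<lambda>j. {y \<in> topspace ?Y. (u, fst y, snd y) \<in> G j}"
    have uU: "u \<in> U" using u mU by (auto simp: A_def)
    have E: "openin ?Y (?E j)" for j
    proof (rule openin_continuous_map_preimage[OF _ G])
      have "continuous_map ?Y euclideanreal snd"
        using continuous_map_snd[of "mtop \<Lambda>" "top_of_set {0<..}"] continuous_map_in_subtopology by blast
      then show "continuous_map ?Y ?T (\<lambda>y. (u, fst y, snd y))"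
        using uU mU by (auto simp: continuous_map_pairwise o_def continuous_map_const continuous_map_fst)
    qed
    have cY: "connected_space ?Y"
      using conn connected_Ioi[of "0::real"] connectedin_iff_connected[of "{0::real<..}"]
      by (auto simp: connected_space_prod_topology connectedin_def simp del: connectedin_iff_connected)
    have cover: "topspace ?Y \<subseteq> ?E True \<union> ?E False"
    proof
      fix y assume y: "y \<in> topspace ?Y"
      then have "\<exists>j. a (u, fst y, snd y) \<in> R j" by (intro sheet uU) auto
      then show "y \<in> ?E True \<union> ?E False" using y uU by (auto simp: G_def ex_bool_eq)
    qed
    have dis: "?E True \<inter> ?E False = {}"
      using sheets_eq[OF R] by (auto simp: G_def)
    have "?E True = {} \<or> ?E False = {}"
    proof (rule ccontr)
      assume "\<not> (?E True = {} \<or> ?E False = {})"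
      then have "?E True \<noteq> {}" "?E False \<noteq> {}" by simp_all
      then show False by (rule connected_spaceD[OF cY E E cover dis])
    qed
    moreover have "(l0, 1) \<in> ?E s" using u l0 by (simp add: A_def)
    ultimately have "?E (\<not> s) = {}" by (cases s) auto
    moreover obtain j where "a (u, l, t) \<in> R j" using sheet[OF uU l, of t] t by blast
    then have "(l, t) \<in> ?E j" using uU l t by (simp add: G_def)
    ultimately have "j = s" by (cases j; cases s) auto
    then show ?thesis using \<open>a (u, l, t) \<in> R j\<close> by simp
  qed
  \<comment> \<open>Read as a label, \<open>(0 < t) = s\<close> is \<open>s\<close> on the positive
    half and its negation on the negative half.\<close>
  have "a (u, l, t) \<in> R ((0 < t) = s)" if u: "u \<in> A" and l: "l \<in> mcarrier \<Lambda>" and t: "t \<noteq> 0" for u l t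
  proof (cases "0 < t")
    case True
    then show ?thesis using pos[OF u l] by simp
  next
    case False
    have uU: "u \<in> U" using u mU by (auto simp: A_def)
    obtain j where j: "a (u, l, t) \<in> R j" using sheet[OF uU l t] by blast
    have "j \<noteq> s"
    proof
      assume "j = s"
      moreover have "a (u, l, -t) \<in> R s" using pos[OF u l, of "-t"] False t by simp
      moreover have "\<L> (a (u, l, t)) = \<L> (a (u, l, -t))" by (simp add: fold_chartD(4)[OF a uU l])
      ultimately have "a (u, l, t) = a (u, l, -t)" using sheets_inj[OF R] j by blast
      then have "(u, l, t) = (u, l, -t)" using fold_chartD(2)[OF a uU l] by metis
      then show False using t by simp
    qed
    then show ?thesis using j False by (cases j; cases s) auto
  qed
  moreover have "u0 \<in> A" using u0 l0 s mU by (simp add: A_def G_def)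
  ultimately show ?thesis using that A by blast
qed

section \<open>Lifting one unfolding through another\<close>

text \<open>Lying over \<open>L1\<close> leaves two candidate values above each regular point; the
  condition on the sheets selects one. It is this condition that makes any two lifts agree on the
  bubbles.\<close>

definition local_lift ::
  "('b, 'd::euclidean_space) mfd \<Rightarrow> ('b \<Rightarrow> 'a) \<Rightarrow> (bool \<Rightarrow> 'b set) \<Rightarrow>
   ('c, 'e::euclidean_space) mfd \<Rightarrow> ('c \<Rightarrow> 'a) \<Rightarrow> (bool \<Rightarrow> 'c set) \<Rightarrow> 'b set \<Rightarrow> ('b \<Rightarrow> 'c) \<Rightarrow> bool" where
  "local_lift X1 L1 R1 X2 L2 R2 N f \<longleftrightarrow>
     openin (mtop X1) N \<and> (\<forall>y\<in>N. smooth_at X1 X2 f y \<and> L2 (f y) = L1 y) \<and>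
     (\<forall>j. f ` (N \<inter> R1 j) \<subseteq> R2 j)"

lemma local_lift_regular:
  assumes M: "smooth_atlas X1" "smooth_atlas X2" "smooth_atlas (regular X)"
    and R1: "sheets X X1 L1 R1" and R2: "sheets X X2 L2 R2"
  shows "\<exists>f. local_lift X1 L1 R1 X2 L2 R2 (R1 j) f"
proof -
  obtain g where g:
    "\<And>x. x \<in> mcarrier (regular X) \<Longrightarrow> g x \<in> R2 j \<and> L2 (g x) = x \<and> smooth_at (regular X) X2 g x"
    using sheets_section[OF R2, of j] by metis
  have L1: "smooth_at X1 (regular X) L1 z" if "z \<in> R1 j" for z
    using sheets_section[OF R1, of j] that by metis
  have reg: "L1 z \<in> mcarrier (regular X)" if "z \<in> R1 j" for z
    using sheets_ex_iff[OF R1] that by blast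
  have "local_lift X1 L1 R1 X2 L2 R2 (R1 j) (\<lambda>z. g (L1 z))"
    unfolding local_lift_def
  proof (intro conjI ballI allI)
    show "openin (mtop X1) (R1 j)" using sheets_openin[OF R1] .
    fix y assume y: "y \<in> R1 j"
    show "smooth_at X1 X2 (\<lambda>z. g (L1 z)) y"
      using smooth_at_compose[OF M(1,3,2) L1[OF y]] g[OF reg[OF y]] by blast
    show "L2 (g (L1 y)) = L1 y" using g[OF reg[OF y]] by blast
  next
    fix i show "(\<lambda>z. g (L1 z)) ` (R1 j \<inter> R1 i) \<subseteq> R2 i"
      using g reg sheets_eq[OF R1] by blast
  qed
  then show ?thesis by blast
qed

text \<open>A proper map is closed, so its image is a closed set containing a dense one. For an
  unfolding this yields points over the singular part, where the covering condition gives
  none.\<close>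

lemma proper_map_onto_closure:
  assumes "proper_map Y Z f" "A \<subseteq> f ` topspace Y" "Z closure_of A = topspace Z"
  shows "f ` topspace Y = topspace Z"
proof -
  have "closedin Z (f ` topspace Y)"
    using proper_imp_closed_map[OF assms(1)] by (simp add: closed_map_def)
  then show ?thesis
    using closure_of_minimal[OF assms(2)] assms(3) closedin_subset by fastforce
qed

text \<open>For \<open>c = - 1\<close> the map exchanges the two sheets.\<close>

lemma smooth_at_fold_transition:
  assumes M: "smooth_atlas S" "smooth_atlas \<Lambda>"
    and U: "U \<subseteq> mcarrier S" and Q: "openin (subtopology (mtop S) U) (U \<inter> V)"
    and g: "smooth_map (prod_mfd (open_submfd S (U \<inter> V)) \<Lambda>) \<Lambda> (\<lambda>(u, l). g u l)"
    and p: "p \<in> (U \<inter> V) \<times> mcarrier \<Lambda> \<times> UNIV"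
  shows "smooth_at (prod_mfd (open_submfd S U) (prod_mfd \<Lambda> real_mfd))
     (prod_mfd (open_submfd S V) (prod_mfd \<Lambda> real_mfd))
     (\<lambda>p. (fst p, g (fst p) (fst (snd p)), c * snd (snd p))) p"
proof -
  let ?P = "prod_mfd (open_submfd S U) (prod_mfd \<Lambda> real_mfd)"
  note at = smooth_atlas_prod_mfd smooth_atlas_open_submfd smooth_atlas_real_mfd M
  have P: "smooth_atlas ?P" by (intro at)
  have LR: "smooth_atlas (prod_mfd \<Lambda> real_mfd)" by (intro at)
  have pP: "p \<in> mcarrier (open_submfd S U) \<times> mcarrier (prod_mfd \<Lambda> real_mfd)" using p U by auto
  have fst: "smooth_at ?P S fst p"
    using smooth_at_fst[OF smooth_atlas_open_submfd[OF M(1)] LR pP] by (rule smooth_at_submfd_codomainD)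
  have o: "openin (mtop ?P) ((U \<inter> V) \<times> mcarrier \<Lambda> \<times> UNIV)"
    using Q by (simp add: openin_prod_Times_iff flip: UNIV_Times_UNIV)
  have snd: "smooth_at ?P (prod_mfd \<Lambda> real_mfd) snd p"
    by (rule smooth_at_snd[OF smooth_atlas_open_submfd[OF M(1)] LR pP])
  have sndp: "snd p \<in> mcarrier \<Lambda> \<times> mcarrier real_mfd" using p by auto
  have l: "smooth_at ?P \<Lambda> (\<lambda>p. fst (snd p)) p"
    by (rule smooth_at_compose[OF P LR M(2) snd smooth_at_fst[OF M(2) smooth_atlas_real_mfd sndp]])
  have t: "smooth_at ?P real_mfd (\<lambda>p. snd (snd p)) p"
    by (rule smooth_at_compose[OF P LR smooth_atlas_real_mfd snd smooth_at_snd[OF M(2) smooth_atlas_real_mfd sndp]])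
  have ct: "smooth_at ?P real_mfd (\<lambda>p. c * snd (snd p)) p"
    by (rule smooth_at_compose[OF P smooth_atlas_real_mfd smooth_atlas_real_mfd t smooth_at_real_mult])
  have uV: "smooth_at ?P (open_submfd S V) fst p"
    by (rule smooth_at_submfd_codomain[OF fst o p]) auto
  have uQ: "smooth_at ?P (open_submfd S (U \<inter> V)) fst p"
    by (rule smooth_at_submfd_codomain[OF fst o p]) auto
  let ?QL = "prod_mfd (open_submfd S (U \<inter> V)) \<Lambda>"
  have QL: "smooth_atlas ?QL" by (intro at)
  have ul: "smooth_at ?P ?QL (\<lambda>p. (fst p, fst (snd p))) p"
    by (rule smooth_at_Pair[OF P smooth_atlas_open_submfd[OF M(1)] M(2) uQ l])
  have "smooth_at ?QL \<Lambda> (\<lambda>(u, l). g u l) (fst p, fst (snd p))"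
    by (rule smooth_map_imp_smooth_at[OF QL M(2) g]) (use p U in auto)
  from smooth_at_compose[OF P QL M(2) ul this]
  have "smooth_at ?P \<Lambda> (\<lambda>p. g (fst p) (fst (snd p))) p" by simp
  then show ?thesis
    by (intro smooth_at_Pair P at uV ct)
qed

text \<open>The lift is the composite of \<open>b\<close>, \<open>h\<close> and \<open>a'\<close>:
  into the folded coordinates of the first unfolding, across by the tubular transition, out through
  the folded chart of the second. The neighborhood lies over base points where both sheet labels are
  constant, so one sign serves all of it.\<close>

lemma local_lift_singular:
  assumes X: "thom_mather_spm X Lk Tb"
    and X1: "primary_unfolding X Lk Tb X1 L1" and R1: "sheets X X1 L1 R1"
    and X2: "primary_unfolding X Lk Tb X2 L2" and R2: "sheets X X2 L2 R2"
    and z: "z \<in> mcarrier X1" "L1 z \<in> mcarrier (singular X)"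
  shows "\<exists>N f. local_lift X1 L1 R1 X2 L2 R2 N f \<and> z \<in> N"
proof -
  have spm: "simple_pseudomanifold X Lk" and sX: "simple_space X"
    using X by (auto simp: thom_mather_spm_def simple_pseudomanifold_def)
  have sing: "smooth_atlas (singular X)"
    and disj: "mcarrier (regular X) \<inter> mcarrier (singular X) = {}"
    and un: "mcarrier (regular X) \<union> mcarrier (singular X) = topspace (space_top X)"
    and clo: "space_top X closure_of mcarrier (regular X) = topspace (space_top X)"
    and tsing: "mtop (singular X) = subtopology (space_top X) (mcarrier (singular X))"
    using sX by (auto simp: simple_space_def intro: manifold_imp_smooth_atlas)
  have u1: "unfolding_with X Lk (\<lambda>S. tube_charts (Tb S)) X1 L1"
    and u2: "unfolding_with X Lk (\<lambda>S. tube_charts (Tb S)) X2 L2"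
    using X1 X2 by (auto simp: primary_unfolding_def thom_mather_unfolding_def)
  have M: "smooth_atlas X1" "smooth_atlas X2"
    and cont1: "continuous_map (mtop X1) (space_top X) L1" and prop2: "proper_map (mtop X2) (space_top X) L2"
    using u1 u2 by (auto simp: unfolding_with_def intro: manifold_imp_smooth_atlas)
  obtain S U \<alpha> a b where c1: "S \<in> singular_strata X" "(U, \<alpha>) \<in> tube_charts (Tb S)"
    "cone_chart X Lk S U \<alpha>" "L1 z \<in> U" and a: "fold_chart X (Lk S) U \<alpha> X1 L1 a b"
    using unfolding_fold_chart[OF spm u1 z] .
  \<comment> \<open>A folded chart of the second unfolding is available only at one of its points,
    so a point \<open>w\<close> over \<open>L1 z\<close> is needed. Sections of one sheet reach the
    regular part, and closedness of the image does the rest.\<close>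
  have "mcarrier (regular X) \<subseteq> L2 ` mcarrier X2"
  proof
    fix x assume x: "x \<in> mcarrier (regular X)"
    obtain g where "g x \<in> R2 True" "L2 (g x) = x" using sheets_section[OF R2, of True] x by metis
    then show "x \<in> L2 ` mcarrier X2" using sheets_ex_iff[OF R2, of "g x"] by (metis image_eqI)
  qed
  then have "L2 ` mcarrier X2 = topspace (space_top X)"
    using proper_map_onto_closure[OF prop2 _ clo] by blast
  then have "L1 z \<in> L2 ` mcarrier X2" using z(2) un by auto
  then obtain w where w: "w \<in> mcarrier X2" "L2 w = L1 z" by (metis imageE)
  have w2: "L2 w \<in> mcarrier (singular X)" using w z by simp
  obtain S' V \<beta> a' b' where c2': "S' \<in> singular_strata X" "(V, \<beta>) \<in> tube_charts (Tb S')"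
    "cone_chart X Lk S' V \<beta>" "L2 w \<in> V" "fold_chart X (Lk S') V \<beta> X2 L2 a' b'"
    using unfolding_fold_chart[OF spm u2 w(1) w2] .
  have US: "U \<subseteq> S" using cone_chart_subset_stratum[OF sX c1(1,3)] .
  have "V \<subseteq> S'" using cone_chart_subset_stratum[OF sX c2'(1,3)] .
  \<comment> \<open>Strata are connected components, and both contain \<open>L1 z\<close>. Hence
    both folded charts come from the same tubular neighborhood and have a transition
    \<open>g\<close>.\<close>
  then have "S' = S"
    using US c1(1,4) c2'(1,4) w(2) connected_components_of_overlap[of S "mtop (singular X)" S']
    by (auto simp: singular_strata_def)
  note c2 = c2'[unfolded this]
  define \<Lambda> where "\<Lambda> = Lk S"
  have \<Lambda>: "smooth_atlas \<Lambda>" "connected_space (mtop \<Lambda>)"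
    using spm c1(1) by (auto simp: \<Lambda>_def simple_pseudomanifold_def intro: manifold_imp_smooth_atlas)
  note a = a[folded \<Lambda>_def] and a' = c2(5)[folded \<Lambda>_def]
  have U: "U \<subseteq> mcarrier (singular X)" and V: "V \<subseteq> mcarrier (singular X)"
    using cone_chart_subset_singular[OF sX c1(1,3)] cone_chart_subset_singular[OF sX c1(1) c2(3)] .
  note reg1 = cone_chart_regular[OF sX c1(1,3), folded \<Lambda>_def]
    and reg2 = cone_chart_regular[OF sX c1(1) c2(3), folded \<Lambda>_def]
    and vert1 = cone_chart_vertex[OF sX c1(1,3), folded \<Lambda>_def]
  have tub: "tubular_neighborhood X Lk S (Tb S)"
    using X c1(1) by (simp add: thom_mather_spm_def)
  have xUV: "L1 z \<in> U \<inter> V" using c1(4) c2(4) w(2) by simp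
  have "\<exists>g. (\<forall>u\<in>U \<inter> V. diffeomorphism \<Lambda> \<Lambda> (g u)) \<and>
             smooth_map (prod_mfd (open_submfd (singular X) (U \<inter> V)) \<Lambda>) \<Lambda> (\<lambda>(u, l). g u l) \<and>
             (\<forall>u\<in>U \<inter> V. \<forall>l\<in>mcarrier \<Lambda>. \<forall>r\<ge>0. \<alpha> (u, cone_pt \<Lambda> l r) = \<beta> (u, cone_pt \<Lambda> (g u l) r))"
  proof -
    have "\<forall>(U, \<alpha>)\<in>tube_charts (Tb S). \<forall>(V, \<beta>)\<in>tube_charts (Tb S). U \<inter> V \<noteq> {} \<longrightarrow>
        (\<exists>g. (\<forall>u\<in>U \<inter> V. diffeomorphism \<Lambda> \<Lambda> (g u)) \<and>
             smooth_map (prod_mfd (open_submfd (singular X) (U \<inter> V)) \<Lambda>) \<Lambda> (\<lambda>(u, l). g u l) \<and>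
             (\<forall>u\<in>U \<inter> V. \<forall>l\<in>mcarrier \<Lambda>. \<forall>r\<ge>0. \<alpha> (u, cone_pt \<Lambda> l r) = \<beta> (u, cone_pt \<Lambda> (g u l) r)))"
      using tub unfolding tubular_neighborhood_def \<Lambda>_def by (elim conjE)
    from bspec[OF this c1(2)] c2(2) xUV show ?thesis by fast
  qed
  then obtain g where g: "\<And>u. u \<in> U \<inter> V \<Longrightarrow> diffeomorphism \<Lambda> \<Lambda> (g u)"
    "smooth_map (prod_mfd (open_submfd (singular X) (U \<inter> V)) \<Lambda>) \<Lambda> (\<lambda>(u, l). g u l)"
    "\<And>u l r. u \<in> U \<inter> V \<Longrightarrow> l \<in> mcarrier \<Lambda> \<Longrightarrow> 0 \<le> r \<Longrightarrow> \<alpha> (u, cone_pt \<Lambda> l r) = \<beta> (u, cone_pt \<Lambda> (g u l) r)"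
    by blast
  have g_in: "g u l \<in> mcarrier \<Lambda>" if "u \<in> U \<inter> V" "l \<in> mcarrier \<Lambda>" for u l
    using g(1)[OF that(1)] that(2) by (auto simp: diffeomorphism_def smooth_map_def continuous_map_def)
  let ?C1 = "preim X1 L1 (chart_image \<Lambda> U \<alpha>)"
  have zC: "z \<in> ?C1"
    using cone_chart_subset_image[OF sX c1(1,3)] c1(4) z(1) by (auto simp: preim_def \<Lambda>_def)
  \<comment> \<open>The singular fibre is exactly \<open>t = 0\<close>, and there the base
    coordinate is the image point itself, since a cone chart is the identity on vertices.\<close>
  have b_iff: "L1 y \<in> mcarrier (singular X) \<longleftrightarrow> snd (snd (b y)) = 0"
      "L1 y \<in> mcarrier (singular X) \<Longrightarrow> fst (b y) = L1 y" if y: "y \<in> ?C1" for y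
  proof -
    obtain u l t where ult: "b y = (u, l, t)" "u \<in> U" "l \<in> mcarrier \<Lambda>"
      using fold_chart_inverseD(1)[OF a y] by auto
    have L: "L1 y = \<alpha> (u, cone_pt \<Lambda> l \<bar>t\<bar>)"
      using fold_chart_inverseD(2)[OF a y] fold_chartD(4)[OF a ult(2,3), of t] ult(1) by simp
    have r: "t \<noteq> 0 \<Longrightarrow> L1 y \<in> mcarrier (regular X)" using reg1[OF ult(2,3), of "\<bar>t\<bar>"] L by simp
    have v: "t = 0 \<Longrightarrow> L1 y = u" using vert1[OF ult(2)] L by simp
    show "L1 y \<in> mcarrier (singular X) \<longleftrightarrow> snd (snd (b y)) = 0"
      "L1 y \<in> mcarrier (singular X) \<Longrightarrow> fst (b y) = L1 y"
      using r v ult U disj by auto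
  qed
  \<comment> \<open>The link coordinate of \<open>z\<close> shows that the link is nonempty and
    serves as test point for the labels of both unfoldings.\<close>
  have l1: "fst (snd (b z)) \<in> mcarrier \<Lambda>"
    using fold_chart_inverseD(1)[OF a zC] by auto
  obtain A s where A: "openin (subtopology (mtop (singular X)) U) A" "L1 z \<in> A"
    "\<And>u l t. u \<in> A \<Longrightarrow> l \<in> mcarrier \<Lambda> \<Longrightarrow> t \<noteq> 0 \<Longrightarrow> a (u, l, t) \<in> R1 ((0 < t) = s)"
    using fold_chart_sheet[OF a R1 M(1) \<Lambda>(1) sing U \<Lambda>(2) reg1 _ l1] xUV by blast
  obtain A' s' where A': "openin (subtopology (mtop (singular X)) V) A'" "L1 z \<in> A'"
    "\<And>u l t. u \<in> A' \<Longrightarrow> l \<in> mcarrier \<Lambda> \<Longrightarrow> t \<noteq> 0 \<Longrightarrow> a' (u, l, t) \<in> R2 ((0 < t) = s')"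
    using fold_chart_sheet[OF a' R2 M(2) \<Lambda>(1) sing V \<Lambda>(2) reg2 _ l1] xUV by blast
  have AU: "A \<subseteq> U" and AV: "A' \<subseteq> V" using openin_subset[OF A(1)] openin_subset[OF A'(1)] by auto
  \<comment> \<open>\<open>V\<close> is known to be open only in its stratum. Because
    \<open>U\<close> lies in the same stratum, the open set cutting \<open>V\<close> out of it also
    cuts \<open>U \<inter> V\<close> out of \<open>U\<close>.\<close>
  obtain T2 where T2: "openin (space_top X) T2" "V = T2 \<inter> S"
    using c2(3) by (auto simp: cone_chart_def openin_subtopology)
  have "openin (mtop (singular X)) (T2 \<inter> mcarrier (singular X))"
    using T2(1) by (subst tsing) (simp add: openin_subtopology_Int)
  then have "openin (subtopology (mtop (singular X)) U) (T2 \<inter> mcarrier (singular X) \<inter> U)"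
    by (simp add: openin_subtopology_Int)
  moreover have "T2 \<inter> mcarrier (singular X) \<inter> U = U \<inter> V" using T2(2) US U by auto
  ultimately have UV: "openin (subtopology (mtop (singular X)) U) (U \<inter> V)" by simp
  \<comment> \<open>\<open>A'\<close> is open relative to \<open>V\<close>, whereas openness in
    \<open>U\<close> is wanted. The set just shown to be open in \<open>U\<close> allows the
    passage.\<close>
  obtain T' where T': "openin (mtop (singular X)) T'" "A' = T' \<inter> V"
    using A'(1) by (auto simp: openin_subtopology)
  have "openin (subtopology (mtop (singular X)) U) (A \<inter> (U \<inter> V) \<inter> (T' \<inter> U))"
    by (rule openin_Int[OF openin_Int[OF A(1) UV] openin_subtopology_Int[OF T'(1)]])
  moreover have "A \<inter> (U \<inter> V) \<inter> (T' \<inter> U) = A \<inter> A'" using AU T'(2) by auto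
  ultimately have Q: "openin (subtopology (mtop (singular X)) U) (A \<inter> A')" by simp
  let ?P = "prod_mfd (open_submfd (singular X) U) (prod_mfd \<Lambda> real_mfd)"
  let ?P' = "prod_mfd (open_submfd (singular X) V) (prod_mfd \<Lambda> real_mfd)"
  have P: "smooth_atlas ?P" "smooth_atlas ?P'"
    by (intro smooth_atlas_prod_mfd smooth_atlas_open_submfd smooth_atlas_real_mfd sing \<Lambda>(1))+
  \<comment> \<open>The sign for which \<open>(0 < t) = s\<close> and
    \<open>(0 < c * t) = s'\<close> are the same label whenever \<open>t \<noteq> 0\<close>: it is
    negative exactly if the positive halves carry different labels.\<close>
  define c :: real where "c = (if s = s' then 1 else -1)"
  define h where "h p = (fst p, g (fst p) (fst (snd p)), c * snd (snd p))" for p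
  define N where "N = {y \<in> ?C1. b y \<in> (A \<inter> A') \<times> mcarrier \<Lambda> \<times> UNIV}"
  have C1: "openin (mtop X1) ?C1"
    unfolding \<Lambda>_def by (rule openin_preim[OF cont1 openin_chart_image[OF sX c1(1,3)]])
  have "openin (mtop ?P) ((A \<inter> A') \<times> mcarrier \<Lambda> \<times> UNIV)"
    using Q by (simp add: openin_prod_Times_iff flip: UNIV_Times_UNIV)
  then have N: "openin (mtop X1) N"
    unfolding N_def using smooth_at_openin_preimage[OF M(1) P(1) fold_chart_inverseD(3)[OF a] C1] by blast
  have zN: "z \<in> N"
    using zC fold_chart_inverseD(1)[OF a zC] b_iff(2)[OF zC z(2)] A(2) A'(2)
    by (auto simp: N_def mem_Times_iff)
  have "local_lift X1 L1 R1 X2 L2 R2 N (\<lambda>y. a' (h (b y)))"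
    unfolding local_lift_def
  proof (intro conjI ballI allI)
    show "openin (mtop X1) N" by (rule N)
    fix y assume y: "y \<in> N"
    then have yC: "y \<in> ?C1" by (simp add: N_def)
    obtain u l t where ult: "b y = (u, l, t)" "u \<in> A" "u \<in> A'" "l \<in> mcarrier \<Lambda>"
      using y by (auto simp: N_def)
    have uUV: "u \<in> U \<inter> V" using ult AU AV by auto
    have hb: "h (b y) = (u, g u l, c * t)" by (simp add: h_def ult(1))
    have gl: "g u l \<in> mcarrier \<Lambda>" using g_in[OF uUV ult(4)] .
    have uV: "u \<in> V" and uU: "u \<in> U" using uUV by auto
    have hs: "smooth_at ?P ?P' h (b y)"
      unfolding h_def[abs_def]
      by (rule smooth_at_fold_transition[OF sing \<Lambda>(1) U UV g(2)]) (use ult uUV in auto)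
    show "smooth_at X1 X2 (\<lambda>y. a' (h (b y))) y"
    proof (rule smooth_at_compose[OF M(1) P(2) M(2)])
      show "smooth_at X1 ?P' (\<lambda>y. h (b y)) y"
        by (rule smooth_at_compose[OF M(1) P fold_chart_inverseD(3)[OF a yC] hs])
      show "smooth_at ?P' X2 a' (h (b y))" unfolding hb by (rule fold_chartD(3)[OF a' uV gl])
    qed
    \<comment> \<open>The sign is invisible in \<open>X\<close> because
      \<open>\<bar>c * t\<bar> = \<bar>t\<bar>\<close>; what remains is the identity between
      \<open>\<alpha>\<close> and \<open>\<beta>\<close> provided by \<open>g\<close>.\<close>
    have "L2 (a' (h (b y))) = \<beta> (u, cone_pt \<Lambda> (g u l) \<bar>t\<bar>)"
      unfolding hb fold_chartD(4)[OF a' uV gl] by (simp add: c_def abs_mult)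
    also have "\<dots> = \<alpha> (u, cone_pt \<Lambda> l \<bar>t\<bar>)" using g(3)[OF uUV ult(4)] by simp
    also have "\<dots> = L1 (a (b y))" unfolding ult(1) using fold_chartD(4)[OF a uU ult(4)] by simp
    finally show "L2 (a' (h (b y))) = L1 y" using fold_chart_inverseD(2)[OF a yC] by simp
  next
    fix j
    show "(\<lambda>y. a' (h (b y))) ` (N \<inter> R1 j) \<subseteq> R2 j"
    proof (intro image_subsetI)
      fix y assume y: "y \<in> N \<inter> R1 j"
      then have yC: "y \<in> ?C1" by (simp add: N_def)
      obtain u l t where ult: "b y = (u, l, t)" "u \<in> A" "u \<in> A'" "l \<in> mcarrier \<Lambda>"
        using y by (auto simp: N_def)
      have uUV: "u \<in> U \<inter> V" using ult AU AV by auto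
      have "L1 y \<in> mcarrier (regular X)" using sheets_ex_iff[OF R1, of y] y by blast
      then have t: "t \<noteq> 0" using b_iff(1)[OF yC] ult(1) disj by auto
      have "y = a (u, l, t)" using fold_chart_inverseD(2)[OF a yC] ult(1) by simp
      then have "y \<in> R1 ((0 < t) = s)" using A(3)[OF ult(2,4) t] by simp
      then have "j = ((0 < t) = s)" using sheets_eq[OF R1] y by blast
      also have "\<dots> = ((0 < c * t) = s')" using t by (auto simp: c_def)
      finally have j: "j = ((0 < c * t) = s')" .
      have "a' (u, g u l, c * t) \<in> R2 ((0 < c * t) = s')"
        by (rule A'(3)[OF ult(3) g_in[OF uUV ult(4)]]) (use t in \<open>simp add: c_def\<close>)
      then show "a' (h (b y)) \<in> R2 j" unfolding j by (simp add: h_def ult(1))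
    qed
  qed
  then show ?thesis using zN by blast
qed

section \<open>Gluing\<close>

text \<open>Density of the regular part of \<open>X\<close> alone does not pass to preimages. Over a
  singular point one moves along the line through \<open>z\<close> in the \<open>t\<close> direction
  of a folded chart: an open set of parameters containing that of \<open>z\<close> also contains a
  nonzero one, and nonzero parameters lie over the regular part.\<close>

lemma sheets_dense:
  assumes X: "simple_pseudomanifold X Lk" and Xt: "unfolding_with X Lk Ch Xt \<L>" and R: "sheets X Xt \<L> R"
    and O: "openin (mtop Xt) B" "z \<in> B"
  shows "\<exists>y j. y \<in> B \<and> y \<in> R j"
proof (cases "\<L> z \<in> mcarrier (singular X)")
  case False
  have z: "z \<in> mcarrier Xt" using openin_subset[OF O(1)] O(2) by blast
  have "\<L> z \<in> topspace (space_top X)"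
    using Xt z by (auto simp: unfolding_with_def continuous_map_def)
  then have "\<L> z \<in> mcarrier (regular X)"
    using X False by (auto simp: simple_pseudomanifold_def simple_space_def)
  then show ?thesis using sheets_ex_iff[OF R, of z] z O(2) by blast
next
  case True
  have z: "z \<in> mcarrier Xt" using openin_subset[OF O(1)] O(2) by blast
  have sX: "simple_space X" using X by (simp add: simple_pseudomanifold_def)
  obtain S U \<alpha> a b where c: "S \<in> singular_strata X" "cone_chart X Lk S U \<alpha>" "\<L> z \<in> U"
    and a: "fold_chart X (Lk S) U \<alpha> Xt \<L> a b"
    using unfolding_fold_chart[OF X Xt z True] by metis
  have at: "smooth_atlas Xt" "smooth_atlas (Lk S)" "smooth_atlas (singular X)"
    using X Xt c(1) by (auto simp: unfolding_with_def simple_pseudomanifold_def simple_space_def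
        intro: manifold_imp_smooth_atlas)
  have U: "U \<subseteq> mcarrier (singular X)" using cone_chart_subset_singular[OF sX c(1,2)] .
  have zC: "z \<in> preim Xt \<L> (chart_image (Lk S) U \<alpha>)"
    using cone_chart_subset_image[OF sX c(1,2)] c(3) z by (auto simp: preim_def)
  obtain u l t where ult: "b z = (u, l, t)" "u \<in> U" "l \<in> mcarrier (Lk S)"
    using fold_chart_inverseD(1)[OF a zC] by auto
  let ?T = "prod_topology (subtopology (mtop (singular X)) U) (prod_topology (mtop (Lk S)) euclideanreal)"
  have "openin euclideanreal {r \<in> topspace euclideanreal. (u, l, r) \<in> {p \<in> U \<times> mcarrier (Lk S) \<times> UNIV. a p \<in> B}}"
  proof (rule openin_continuous_map_preimage)
    show "openin ?T {p \<in> U \<times> mcarrier (Lk S) \<times> UNIV. a p \<in> B}"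
      by (rule fold_chart_openin_preimage[OF a at U O(1)])
    show "continuous_map euclideanreal ?T (\<lambda>r. (u, l, r))"
      using ult U by (auto simp: continuous_map_paired continuous_map_const)
  qed
  then have "open {r. a (u, l, r) \<in> B}" using ult by simp
  moreover have "t \<in> {r. a (u, l, r) \<in> B}"
    using fold_chart_inverseD(2)[OF a zC] ult(1) O(2) by simp
  ultimately have "\<not> {r. a (u, l, r) \<in> B} \<subseteq> {0}"
    using not_open_singleton[of "0::real"] by (metis empty_iff subset_singletonD)
  then obtain r where r: "a (u, l, r) \<in> B" "r \<noteq> 0" by blast
  have "\<L> (a (u, l, r)) \<in> mcarrier (regular X)"
    using cone_chart_regular[OF sX c(1,2) ult(2,3), of "\<bar>r\<bar>"] r(2) fold_chartD(4)[OF a ult(2,3)] by simp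
  moreover have "a (u, l, r) \<in> mcarrier Xt" using openin_subset[OF O(1)] r(1) by blast
  ultimately show ?thesis using sheets_ex_iff[OF R, of "a (u, l, r)"] r(1) by blast
qed

text \<open>If the values differed, disjoint neighborhoods of them would pull back to a neighborhood
  of \<open>z\<close>, which contains a sheet point where both maps agree. This serves both for
  gluing lifts and for identifying a composite of lifts with the identity.\<close>

lemma smooth_at_eq_of_sheets:
  assumes M: "smooth_atlas X1" and N: "smooth_atlas Y" "Hausdorff_space (mtop Y)"
    and dense: "\<And>B. openin (mtop X1) B \<Longrightarrow> z \<in> B \<Longrightarrow> \<exists>y j. y \<in> B \<and> y \<in> (R j :: 'b set)"
    and f: "smooth_at X1 Y f z" and f': "smooth_at X1 Y f' z"
    and B: "openin (mtop X1) B" "z \<in> B" and eq: "\<And>y j. y \<in> B \<Longrightarrow> y \<in> R j \<Longrightarrow> f y = f' y"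
  shows "f z = f' z"
proof (rule ccontr)
  assume "f z \<noteq> f' z"
  then obtain V V' where V: "openin (mtop Y) V" "openin (mtop Y) V'" "f z \<in> V" "f' z \<in> V'" "disjnt V V'"
    using N(2) smooth_at_imp_in_carrier[OF N(1) f] smooth_at_imp_in_carrier[OF N(1) f']
    unfolding Hausdorff_space_def by metis
  obtain O1 where O1: "openin (mtop X1) O1" "z \<in> O1" "f ` O1 \<subseteq> V"
    using smooth_at_continuous[OF M N(1) f V(1,3)] .
  obtain O2 where O2: "openin (mtop X1) O2" "z \<in> O2" "f' ` O2 \<subseteq> V'"
    using smooth_at_continuous[OF M N(1) f' V(2,4)] .
  obtain y j where "y \<in> B \<inter> O1 \<inter> O2" "y \<in> R j"
    using dense[of "B \<inter> O1 \<inter> O2"] B O1 O2 by blast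
  then have "f y = f' y" "f y \<in> V" "f' y \<in> V'" using eq O1(3) O2(3) by auto
  then show False using V(5) by (auto simp: disjnt_iff)
qed

lemma primary_unfolding_atlas:
  assumes "primary_unfolding X Lk Tb Xt \<L>"
  shows "unfolding_with X Lk (\<lambda>S. tube_charts (Tb S)) Xt \<L>" "smooth_atlas Xt" "Hausdorff_space (mtop Xt)"
  using assms manifold_imp_smooth_atlas[of Xt]
  by (auto simp: primary_unfolding_def thom_mather_unfolding_def unfolding_with_def manifold_def)

lemma global_lift:
  assumes X: "thom_mather_spm X Lk Tb"
    and X1: "primary_unfolding X Lk Tb X1 L1" and R1: "sheets X X1 L1 R1"
    and X2: "primary_unfolding X Lk Tb X2 L2" and R2: "sheets X X2 L2 R2"
  shows "\<exists>\<phi>. local_lift X1 L1 R1 X2 L2 R2 (mcarrier X1) \<phi>"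
proof -
  have spm: "simple_pseudomanifold X Lk" and sX: "simple_space X"
    using X by (auto simp: thom_mather_spm_def simple_pseudomanifold_def)
  note u1 = primary_unfolding_atlas[OF X1] and u2 = primary_unfolding_atlas[OF X2]
  have reg: "smooth_atlas (regular X)" using sX by (auto simp: simple_space_def intro: manifold_imp_smooth_atlas)
  let ?lift = "local_lift X1 L1 R1 X2 L2 R2"
  have ex: "\<exists>N f. ?lift N f \<and> z \<in> N" if z: "z \<in> mcarrier X1" for z
  proof (cases "L1 z \<in> mcarrier (singular X)")
    case True
    then show ?thesis using local_lift_singular[OF X X1 R1 X2 R2 z] by blast
  next
    case False
    have "L1 z \<in> topspace (space_top X)"
      using u1(1) z by (auto simp: unfolding_with_def continuous_map_def)
    then have "L1 z \<in> mcarrier (regular X)" using sX False by (auto simp: simple_space_def)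
    then obtain j where "z \<in> R1 j" using sheets_ex_iff[OF R1, of z] z by blast
    then show ?thesis using local_lift_regular[OF u1(2) u2(2) reg R1 R2, of j] by blast
  qed
  \<comment> \<open>At a sheet point both values lie in the same sheet over the same point of
    \<open>X\<close>, and \<open>L2\<close> is injective on a sheet.\<close>
  have agree: "f z = f' z" if f: "?lift N f" "z \<in> N" and f': "?lift N' f'" "z \<in> N'" for N f N' f' z
  proof (rule smooth_at_eq_of_sheets[OF u1(2) u2(2,3) sheets_dense[OF spm u1(1) R1]])
    show "openin (mtop X1) (N \<inter> N')" "z \<in> N \<inter> N'" "smooth_at X1 X2 f z" "smooth_at X1 X2 f' z"
      using f f' by (auto simp: local_lift_def)
    fix y j assume y: "y \<in> N \<inter> N'" "y \<in> R1 j"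
    then have "f y \<in> R2 j" "f' y \<in> R2 j" "L2 (f y) = L2 (f' y)"
      using f f' by (auto simp: local_lift_def image_subset_iff)
    then show "f y = f' y" using sheets_inj[OF R2] by blast
  qed
  obtain N F where F: "\<And>z. z \<in> mcarrier X1 \<Longrightarrow> ?lift (N z) (F z) \<and> z \<in> N z"
    using ex by metis
  \<comment> \<open>Each point uses its own chosen lift. By \<open>agree\<close> this coincides with
    \<open>F z\<close> on all of \<open>N z\<close>, from which smoothness at \<open>z\<close> is
    inherited.\<close>
  define \<phi> where "\<phi> z = F z z" for z
  have eq: "\<phi> y = F z y" if z: "z \<in> mcarrier X1" and y: "y \<in> N z" for z y
  proof -
    have "y \<in> mcarrier X1" using F[OF z] y openin_subset by (auto simp: local_lift_def)
    then show ?thesis unfolding \<phi>_def using agree F z y by blast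
  qed
  have "?lift (mcarrier X1) \<phi>"
    unfolding local_lift_def
  proof (intro conjI ballI allI)
    fix z assume z: "z \<in> mcarrier X1"
    note Fz = F[OF z, unfolded local_lift_def]
    show "smooth_at X1 X2 \<phi> z"
      by (rule smooth_at_cong[of X1 X2 "F z" z "N z"]) (use Fz eq[OF z] in auto)
    show "L2 (\<phi> z) = L1 z" using Fz by (auto simp: \<phi>_def)
  next
    fix j show "\<phi> ` (mcarrier X1 \<inter> R1 j) \<subseteq> R2 j"
      using F unfolding local_lift_def \<phi>_def by blast
  qed simp
  then show ?thesis by blast
qed

text \<open>Both lifts preserve labels and the image in \<open>X\<close>, so on a bubble the
  composite returns a point of the same bubble over the same point, which is the original one.
  Density of the bubbles extends this to the points over the singular part.\<close>

lemma global_lift_inverse: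
  assumes X: "simple_pseudomanifold X Lk"
    and u1: "unfolding_with X Lk Ch X1 L1" "smooth_atlas X1" "Hausdorff_space (mtop X1)"
    and u2: "smooth_atlas X2"
    and R1: "sheets X X1 L1 R1" and R2: "sheets X X2 L2 R2"
    and \<phi>: "local_lift X1 L1 R1 X2 L2 R2 (mcarrier X1) \<phi>"
    and \<psi>: "local_lift X2 L2 R2 X1 L1 R1 (mcarrier X2) \<psi>"
    and z: "z \<in> mcarrier X1"
  shows "\<psi> (\<phi> z) = z"
proof (rule smooth_at_eq_of_sheets[OF u1(2,2,3) sheets_dense[OF X u1(1) R1], where B = "mcarrier X1"])
  have \<phi>_in: "\<phi> y \<in> mcarrier X2" if "y \<in> mcarrier X1" for y
    using \<phi> that by (auto simp: local_lift_def intro: smooth_at_imp_in_carrier[OF u2])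
  have \<phi>s: "smooth_at X1 X2 \<phi> z" using \<phi> z by (auto simp: local_lift_def)
  have \<psi>s: "smooth_at X2 X1 \<psi> (\<phi> z)" using \<psi> \<phi>_in[OF z] by (auto simp: local_lift_def)
  show "smooth_at X1 X1 (\<lambda>z. \<psi> (\<phi> z)) z" by (rule smooth_at_compose[OF u1(2) u2 u1(2) \<phi>s \<psi>s])
  show "smooth_at X1 X1 (\<lambda>z. z) z" by (rule smooth_at_id[OF u1(2) z])
  fix y j assume y: "y \<in> mcarrier X1" "y \<in> R1 j"
  then have "\<phi> y \<in> R2 j" using \<phi> by (auto simp: local_lift_def)
  then have "\<psi> (\<phi> y) \<in> R1 j" using \<psi> \<phi>_in[OF y(1)] by (auto simp: local_lift_def)
  moreover have "L1 (\<psi> (\<phi> y)) = L1 y"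
    using \<phi> \<psi> y(1) \<phi>_in[OF y(1)] by (auto simp: local_lift_def)
  ultimately show "\<psi> (\<phi> y) = y" using sheets_inj[OF R1] y(2) by blast
qed (use z in auto)

theorem corollary3p2p2:
  fixes X :: "('a, 'r::euclidean_space, 's::euclidean_space) sspace"
    and Lk :: "'a set \<Rightarrow> ('l, 'k::euclidean_space) mfd"
    and Tb :: "'a set \<Rightarrow> ('a, 'l) tube"
    and X1 :: "('b, 'd::euclidean_space) mfd" and L1 :: "'b \<Rightarrow> 'a"
    and X2 :: "('c, 'e::euclidean_space) mfd" and L2 :: "'c \<Rightarrow> 'a"
  assumes "thom_mather_spm X Lk Tb"
    and "primary_unfolding X Lk Tb X1 L1"
    and "primary_unfolding X Lk Tb X2 L2"
  shows "\<exists>\<phi>. diffeomorphism X1 X2 \<phi> \<and> (\<forall>z\<in>mcarrier X1. L2 (\<phi> z) = L1 z)"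
proof -
  have spm: "simple_pseudomanifold X Lk" and sX: "simple_space X"
    using assms(1) by (auto simp: thom_mather_spm_def simple_pseudomanifold_def)
  obtain R1 where R1: "sheets X X1 L1 R1" using primary_unfolding_sheets[OF sX assms(2)] .
  obtain R2 where R2: "sheets X X2 L2 R2" using primary_unfolding_sheets[OF sX assms(3)] .
  note u1 = primary_unfolding_atlas[OF assms(2)] and u2 = primary_unfolding_atlas[OF assms(3)]
  obtain \<phi> where \<phi>: "local_lift X1 L1 R1 X2 L2 R2 (mcarrier X1) \<phi>"
    using global_lift[OF assms(1,2) R1 assms(3) R2] by blast
  obtain \<psi> where \<psi>: "local_lift X2 L2 R2 X1 L1 R1 (mcarrier X2) \<psi>"
    using global_lift[OF assms(1,3) R2 assms(2) R1] by blast
  have "smooth_map X1 X2 \<phi>" "smooth_map X2 X1 \<psi>"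
    using \<phi> \<psi> by (auto simp: local_lift_def intro!: smooth_mapI u1 u2)
  moreover have "\<forall>z\<in>mcarrier X1. \<psi> (\<phi> z) = z"
    using global_lift_inverse[OF spm u1 u2(2) R1 R2 \<phi> \<psi>] by blast
  moreover have "\<forall>z\<in>mcarrier X2. \<phi> (\<psi> z) = z"
    using global_lift_inverse[OF spm u2 u1(2) R2 R1 \<psi> \<phi>] by blast
  ultimately have "diffeomorphism X1 X2 \<phi>" unfolding diffeomorphism_def by blast
  then show ?thesis using \<phi> by (auto simp: local_lift_def)
qed

end
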